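(* Let $D$ be an infinite division ring and let $N\subseteq D^\times$ be a finite index normal subgroup containing $-1$. Assume that $D^\times/N$ supports a V-graph $\Delta$ of diameter $\ge 4$. Then in each of the following situations: (i) $D$ is commutative, (ii) $D$ is a finite-dimensional division algebra over a field of finite transcendence degree over its prime field, there exists a non-trivial valuation $v$ of $D$ such that $N$ is open in $D$ with respect to the topology defined by $v$.
   Context: V-graphs. Let $D$ be an infinite division ring and $N$ a proper normal subgroup of finite index in $D^\times$ containing $-1$; for $a\in D^\times$ write $a^*=aN\in D^\times/N$. Consider undirected graphs $\Delta$ whose vertices are the non-identity elements of $D^\times/N$; $d(\cdot,\cdot)$ is the distance function on vertices, with $d(a^*,b^* )=\infty$ if $a^*,b^*$ lie in different connected components, and $\mathrm{diam}(\Delta)=\sup d(a^*,b^* )$. Such a $\Delta$ is a V-graph associated with $N$ (and $D^\times/N$ supports the V-graph $\Delta$) if for all $a,b,c\in D^\times\setminus N$: (V1) if $a-b\in N$ then $d(a^*,b^* )\le 1$; (V2) if $d(a^*,b^* )\le 1$ then $d((a^{-1})^*,b^* )\le 1$; (V3) if $ab\notin N$ and both $d(a^*,c^* )\le 1$ and $d(a^*b^*,c^* )\le 1$, then $d(b^*,c^* )\le 1$. Valuations. A valuation on $D$ is a surjective homomorphism $v\colon D^\times\to\Gamma_v$ onto a totally ordered (additively written, not necessarily commutative) group such that $v(a+b)\ge\min(v(a),v(b))$ whenever $a,b\in D^\times$, $b\ne -a$. The $v$-adic topology on $D$ is the ring topology having the sets $\mathfrak m_{D,v}(\delta)=\{x\in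 D^\times\mid v(x)>\delta\}\cup\{0\}$, $\delta\in\Gamma_v$, $\delta\ge 0$, as a fundamental system of neighborhoods of $0$. A subgroup $N\subseteq D^\times$ is open iff $1+\mathfrak m_{D,v}(\delta)\subseteq N$ for some $\delta\ge0$ in $\Gamma_v$. *)

theory Defs
  imports
    "HOL-Algebra.Coset"
    "HOL-Analysis.Abstract_Topology"
    "HOL-Computational_Algebra.Polynomial"
    "HOL-Library.Poly_Mapping"
    "Graph_Theory.Graph_Theory"
begin

section \<open>The multiplicative group of a division ring\<close>

definition mult_group :: "'a::division_ring monoid" where
  "mult_group = \<lparr>carrier = UNIV - {0}, monoid.mult = (*), one = 1\<rparr>"

lemma mult_group_simps [simp]:
  "carrier mult_group = UNIV - {0 :: 'a::division_ring}"
  "x \<otimes>\<^bsub>mult_group\<^esub> y = x * (y :: 'a)"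
  "\<one>\<^bsub>mult_group\<^esub> = (1 :: 'a)"
  by (simp_all add: mult_group_def)

lemma group_mult_group: "group (mult_group :: 'a::division_ring monoid)"
proof (rule groupI)
  show "\<exists>y\<in>carrier mult_group. y \<otimes>\<^bsub>mult_group\<^esub> x = \<one>\<^bsub>mult_group\<^esub>"
    if "x \<in> carrier mult_group" for x :: 'a
    using that by (intro bexI[of _ "inverse x"]) auto
qed (auto simp: mult.assoc)


section \<open>V-graphs\<close>

definition graph_dist :: "'v pair_pre_digraph \<Rightarrow> 'v \<Rightarrow> 'v \<Rightarrow> ereal" where
  "graph_dist \<Delta> x y = wf_digraph.\<mu> (with_proj \<Delta>) (\<lambda>_. 1) x y"

definition graph_diam :: "'v pair_pre_digraph \<Rightarrow> ereal" where
  "graph_diam \<Delta> = (SUP x\<in>pverts \<Delta>. SUP y\<in>pverts \<Delta>. graph_dist \<Delta> x y)"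

text \<open>
  A finite undirected graph is represented as a \<open>pair_graph\<close>, that is, a finite digraph with
  symmetric irreflexive arc relation. The coset \<open>a N\<close> written below lies in the carrier of
  \<open>mult_group Mod N\<close>, which consists of the right cosets \<open>N a\<close>, because \<open>N\<close> is normal in all uses.
\<close>

definition V_graph :: "'a::division_ring set \<Rightarrow> 'a set pair_pre_digraph \<Rightarrow> bool" where
  "V_graph N \<Delta> \<longleftrightarrow>
     N \<noteq> carrier mult_group \<and>
     pair_graph \<Delta> \<and>
     pverts \<Delta> = carrier (mult_group Mod N) - {\<one>\<^bsub>mult_group Mod N\<^esub>} \<and>
     (let X = carrier mult_group - N;
          star = (\<lambda>a. a <#\<^bsub>mult_group\<^esub> N);
          d = graph_dist \<Delta>
      in (\<forall>a\<in>X. \<forall>b\<in>X. a - b \<in> N \<longrightarrow> d (star a) (star b) \<le> 1) \<and>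
         (\<forall>a\<in>X. \<forall>b\<in>X. d (star a) (star b) \<le> 1 \<longrightarrow> d (star (inverse a)) (star b) \<le> 1) \<and>
         (\<forall>a\<in>X. \<forall>b\<in>X. \<forall>c\<in>X.
            a * b \<notin> N \<and> d (star a) (star c) \<le> 1 \<and>
            d (star a \<otimes>\<^bsub>mult_group Mod N\<^esub> star b) (star c) \<le> 1 \<longrightarrow>
            d (star b) (star c) \<le> 1))"


section \<open>Valuations and their topologies\<close>

text \<open>
  The value groups are not necessarily commutative and are written multiplicatively, following
  the conventions for \<open>group\<close>: the neutral element of \<open>\<Gamma>\<close> is \<open>\<one>\<^bsub>\<Gamma>\<^esub>\<close>.
\<close>

record 'g ordered_group = "'g monoid" +
  le_rel :: "'g rel"

locale totally_ordered_group = group \<Gamma>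
  for \<Gamma> :: "('g, 'm) ordered_group_scheme" (structure) +
  assumes linear: "linear_order_on (carrier \<Gamma>) (le_rel \<Gamma>)"
    and mult_left_mono:
      "(x, y) \<in> le_rel \<Gamma> \<Longrightarrow> z \<in> carrier \<Gamma> \<Longrightarrow> (z \<otimes> x, z \<otimes> y) \<in> le_rel \<Gamma>"
    and mult_right_mono:
      "(x, y) \<in> le_rel \<Gamma> \<Longrightarrow> z \<in> carrier \<Gamma> \<Longrightarrow> (x \<otimes> z, y \<otimes> z) \<in> le_rel \<Gamma>"

definition ogroup_min :: "('g, 'm) ordered_group_scheme \<Rightarrow> 'g \<Rightarrow> 'g \<Rightarrow> 'g" where
  "ogroup_min \<Gamma> x y = (if (x, y) \<in> le_rel \<Gamma> then x else y)"

text \<open>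
  The value of \<open>v\<close> at \<open>0\<close> is irrelevant. Since \<open>v\<close> maps the nonzero elements of \<open>'a\<close> onto \<open>\<Gamma>\<close>,
  the fibres of \<open>v\<close> provide a copy of \<open>\<Gamma>\<close> in the type \<open>'a set\<close>; so nothing is lost when the
  existence of a valuation is stated with value groups in this type only.
\<close>

locale valuation = totally_ordered_group \<Gamma>
  for \<Gamma> :: "('g, 'm) ordered_group_scheme" (structure)
    and v :: "'a::division_ring \<Rightarrow> 'g" +
  assumes epi: "v \<in> epi mult_group \<Gamma>"
    and ultrametric:
      "a \<noteq> 0 \<Longrightarrow> b \<noteq> 0 \<Longrightarrow> b \<noteq> - a \<Longrightarrow>
       (ogroup_min \<Gamma> (v a) (v b), v (a + b)) \<in> le_rel \<Gamma>"

definition val_ideal ::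
    "('g, 'm) ordered_group_scheme \<Rightarrow> ('a::division_ring \<Rightarrow> 'g) \<Rightarrow> 'g \<Rightarrow> 'a set" where
  "val_ideal \<Gamma> v \<delta> = {x. x \<noteq> 0 \<and> (\<delta>, v x) \<in> le_rel \<Gamma> \<and> v x \<noteq> \<delta>} \<union> {0}"

definition val_topology ::
    "('g, 'm) ordered_group_scheme \<Rightarrow> ('a::division_ring \<Rightarrow> 'g) \<Rightarrow> 'a topology" where
  "val_topology \<Gamma> v = topology (\<lambda>U.
     \<forall>x\<in>U. \<exists>\<delta>\<in>carrier \<Gamma>. (\<one>\<^bsub>\<Gamma>\<^esub>, \<delta>) \<in> le_rel \<Gamma> \<and> (\<lambda>y. x + y) ` val_ideal \<Gamma> v \<delta> \<subseteq> U)"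

context valuation
begin

lemma le_trans: "(x, y) \<in> le_rel \<Gamma> \<Longrightarrow> (y, z) \<in> le_rel \<Gamma> \<Longrightarrow> (x, z) \<in> le_rel \<Gamma>"
  using linear unfolding order_on_defs by (meson transE)

lemma le_antisym: "(x, y) \<in> le_rel \<Gamma> \<Longrightarrow> (y, x) \<in> le_rel \<Gamma> \<Longrightarrow> x = y"
  using linear unfolding order_on_defs by (meson antisymD)

lemma le_refl: "x \<in> carrier \<Gamma> \<Longrightarrow> (x, x) \<in> le_rel \<Gamma>"
  using linear unfolding order_on_defs by (simp add: refl_on_def)

lemma le_total:
  "x \<in> carrier \<Gamma> \<Longrightarrow> y \<in> carrier \<Gamma> \<Longrightarrow> (x, y) \<in> le_rel \<Gamma> \<or> (y, x) \<in> le_rel \<Gamma>"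
  using linear le_refl unfolding order_on_defs total_on_def by metis

lemma val_ideal_antimono:
  "(\<delta>, \<epsilon>) \<in> le_rel \<Gamma> \<Longrightarrow> val_ideal \<Gamma> v \<epsilon> \<subseteq> val_ideal \<Gamma> v \<delta>"
  unfolding val_ideal_def using le_trans le_antisym by blast

lemma istopology_val:
  "istopology (\<lambda>U. \<forall>x\<in>U. \<exists>\<delta>\<in>carrier \<Gamma>. (\<one>, \<delta>) \<in> le_rel \<Gamma> \<and>
      (\<lambda>y. x + y) ` val_ideal \<Gamma> v \<delta> \<subseteq> U)"
  unfolding istopology_def
proof (intro conjI allI impI ballI, goal_cases)
  case (1 S T x)
  then obtain \<delta> \<epsilon> where *: "\<delta> \<in> carrier \<Gamma>" "(\<one>, \<delta>) \<in> le_rel \<Gamma>"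
      "(\<lambda>y. x + y) ` val_ideal \<Gamma> v \<delta> \<subseteq> S"
      "\<epsilon> \<in> carrier \<Gamma>" "(\<one>, \<epsilon>) \<in> le_rel \<Gamma>" "(\<lambda>y. x + y) ` val_ideal \<Gamma> v \<epsilon> \<subseteq> T"
    by (metis IntD1 IntD2)
  from le_total[OF *(1) *(4)] show ?case
  proof
    assume "(\<delta>, \<epsilon>) \<in> le_rel \<Gamma>"
    then show ?thesis using * val_ideal_antimono[of \<delta> \<epsilon>] by (intro bexI[of _ \<epsilon>]) auto
  next
    assume "(\<epsilon>, \<delta>) \<in> le_rel \<Gamma>"
    then show ?thesis using * val_ideal_antimono[of \<epsilon> \<delta>] by (intro bexI[of _ \<delta>]) auto
  qed
next
  case (2 \<K> x)
  then show ?case by (meson UnionE Union_upper order_trans)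
qed

lemma openin_val_topology:
  "openin (val_topology \<Gamma> v) U \<longleftrightarrow>
     (\<forall>x\<in>U. \<exists>\<delta>\<in>carrier \<Gamma>. (\<one>, \<delta>) \<in> le_rel \<Gamma> \<and> (\<lambda>y. x + y) ` val_ideal \<Gamma> v \<delta> \<subseteq> U)"
  unfolding val_topology_def by (simp add: topology_inverse'[OF istopology_val])

lemma val_mult: "a \<noteq> 0 \<Longrightarrow> b \<noteq> 0 \<Longrightarrow> v (a * b) = v a \<otimes> v b"
  using epi unfolding epi_def hom_def by auto

lemma val_closed: "a \<noteq> 0 \<Longrightarrow> v a \<in> carrier \<Gamma>"
  using epi unfolding epi_def hom_def by auto

lemma openin_subgroup_iff:
  assumes N: "subgroup N mult_group"
  shows "openin (val_topology \<Gamma> v) N \<longleftrightarrow>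
     (\<exists>\<delta>\<in>carrier \<Gamma>. (\<one>, \<delta>) \<in> le_rel \<Gamma> \<and> (\<lambda>y. 1 + y) ` val_ideal \<Gamma> v \<delta> \<subseteq> N)"
proof
  assume "openin (val_topology \<Gamma> v) N"
  then show "\<exists>\<delta>\<in>carrier \<Gamma>. (\<one>, \<delta>) \<in> le_rel \<Gamma> \<and> (\<lambda>y. 1 + y) ` val_ideal \<Gamma> v \<delta> \<subseteq> N"
    using subgroup.one_closed[OF N] by (simp add: openin_val_topology)
next
  assume "\<exists>\<delta>\<in>carrier \<Gamma>. (\<one>, \<delta>) \<in> le_rel \<Gamma> \<and> (\<lambda>y. 1 + y) ` val_ideal \<Gamma> v \<delta> \<subseteq> N"
  then obtain \<delta> where d: "\<delta> \<in> carrier \<Gamma>" "(\<one>, \<delta>) \<in> le_rel \<Gamma>"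
    "(\<lambda>y. 1 + y) ` val_ideal \<Gamma> v \<delta> \<subseteq> N" by blast
  show "openin (val_topology \<Gamma> v) N"
    unfolding openin_val_topology
  proof
    fix x assume x: "x \<in> N"
    then have x0: "x \<noteq> 0" using subgroup.subset[OF N] by auto
    have c: "v x \<in> carrier \<Gamma>" "v (inverse x) \<in> carrier \<Gamma>"
      using x0 by (auto intro: val_closed)
    define \<epsilon>0 where "\<epsilon>0 = v x \<otimes> \<delta>"
    have e0: "\<epsilon>0 \<in> carrier \<Gamma>" using c d unfolding \<epsilon>0_def by simp
    define \<epsilon> where "\<epsilon> = (if (\<one>, \<epsilon>0) \<in> le_rel \<Gamma> then \<epsilon>0 else \<one>)"
    have e: "\<epsilon> \<in> carrier \<Gamma>" "(\<one>, \<epsilon>) \<in> le_rel \<Gamma>" "(\<epsilon>0, \<epsilon>) \<in> le_rel \<Gamma>"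
      using e0 le_refl le_total[OF e0 one_closed] unfolding \<epsilon>_def by auto
    have "x + y \<in> N" if y: "y \<in> val_ideal \<Gamma> v \<epsilon>" for y
    proof (cases "y = 0")
      case False
      have y': "y \<in> val_ideal \<Gamma> v \<epsilon>0" using y val_ideal_antimono[OF e(3)] by blast
      have vy: "v y \<in> carrier \<Gamma>" using False by (rule val_closed)
      have ixy: "v y = v x \<otimes> v (inverse x * y)"
        using val_mult[of x "inverse x * y"] x0 False by (simp add: mult.assoc[symmetric])
      have i: "v (inverse x) \<otimes> v x = \<one>"
      proof -
        have "v (inverse x) \<otimes> v x = v 1" using val_mult[of "inverse x" x] x0 by simp
        moreover have "v 1 = v 1 \<otimes> v 1" using val_mult[of 1 1] by simp
        then have "v 1 = \<one>" using val_closed[of 1] by (metis l_cancel_one' one_neq_zero)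
        ultimately show ?thesis by simp
      qed
      have w: "v (inverse x * y) \<in> carrier \<Gamma>" using x0 False by (intro val_closed) simp
      have "(v (inverse x) \<otimes> \<epsilon>0, v (inverse x) \<otimes> v y) \<in> le_rel \<Gamma>"
        using y' False c by (intro mult_left_mono) (auto simp: val_ideal_def)
      then have "(\<delta>, v (inverse x * y)) \<in> le_rel \<Gamma>"
        using i c d w unfolding \<epsilon>0_def ixy by (simp add: m_assoc[symmetric])
      moreover have "v (inverse x * y) \<noteq> \<delta>"
        using y' False ixy unfolding \<epsilon>0_def val_ideal_def by auto
      ultimately have "inverse x * y \<in> val_ideal \<Gamma> v \<delta>"
        unfolding val_ideal_def using x0 False by auto
      then have "1 + inverse x * y \<in> N" using d by auto
      then have "x * (1 + inverse x * y) \<in> N"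
        using subgroup.m_closed[OF N x] by simp
      then show ?thesis using x0 by (simp add: distrib_left mult.assoc[symmetric])
    qed (use x in simp)
    then show "\<exists>\<delta>\<in>carrier \<Gamma>. (\<one>, \<delta>) \<in> le_rel \<Gamma> \<and> (\<lambda>y. x + y) ` val_ideal \<Gamma> v \<delta> \<subseteq> N"
      using e by blast
  qed
qed

end


section \<open>Transcendence degree\<close>

definition is_subfield :: "'k::field set \<Rightarrow> bool" where
  "is_subfield F \<longleftrightarrow> 1 \<in> F \<and> (\<forall>x\<in>F. \<forall>y\<in>F. x - y \<in> F \<and> x * y \<in> F) \<and> (\<forall>x\<in>F. inverse x \<in> F)"

definition gen_field :: "'k::field set \<Rightarrow> 'k set" where
  "gen_field S = \<Inter> {F. is_subfield F \<and> S \<subseteq> F}"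

definition prime_field :: "'k::field set" where
  "prime_field = \<Inter> {F. is_subfield F}"

definition algebraic_over :: "'k::field set \<Rightarrow> 'k \<Rightarrow> bool" where
  "algebraic_over F x \<longleftrightarrow> (\<exists>p. p \<noteq> 0 \<and> (\<forall>i. coeff p i \<in> F) \<and> poly p x = 0)"

text \<open>
  Multivariate polynomials are finitely supported maps from monomials to coefficients. The
  indeterminates are indexed by the elements of the field, and each indeterminate is evaluated
  at its own index.
\<close>

definition eval_at_indices :: "(('k::field \<Rightarrow>\<^sub>0 nat) \<Rightarrow>\<^sub>0 'k) \<Rightarrow> 'k" where
  "eval_at_indices p =
     (\<Sum>m\<in>Poly_Mapping.keys p. Poly_Mapping.lookup p m *
        (\<Prod>x\<in>Poly_Mapping.keys m. x ^ Poly_Mapping.lookup m x))"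

definition algebraically_independent :: "'k::field set \<Rightarrow> 'k set \<Rightarrow> bool" where
  "algebraically_independent F B \<longleftrightarrow>
     (\<forall>p. (\<forall>m. Poly_Mapping.lookup p m \<in> F) \<and>
          (\<forall>m\<in>Poly_Mapping.keys p. Poly_Mapping.keys m \<subseteq> B) \<and>
          eval_at_indices p = 0 \<longrightarrow> p = 0)"

definition transcendence_basis :: "'k::field set \<Rightarrow> 'k set \<Rightarrow> bool" where
  "transcendence_basis F B \<longleftrightarrow>
     algebraically_independent F B \<and> (\<forall>x. algebraic_over (gen_field (F \<union> B)) x)"

definition finite_transcendence_degree :: "'k::field itself \<Rightarrow> bool" where
  "finite_transcendence_degree _ \<longleftrightarrow>
     (\<exists>B :: 'k set. finite B \<and> transcendence_basis prime_field B)"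


section \<open>Finite-dimensional division algebras\<close>

locale division_algebra = vector_space scale
  for scale :: "'k::field \<Rightarrow> 'a::division_ring \<Rightarrow> 'a" +
  assumes scale_mult_left: "scale c (x * y) = scale c x * y"
    and scale_mult_right: "scale c (x * y) = x * scale c y"

definition finite_dimensional_division_algebra ::
    "('k::field \<Rightarrow> 'a::division_ring \<Rightarrow> 'a) \<Rightarrow> bool" where
  "finite_dimensional_division_algebra scale \<longleftrightarrow>
     division_algebra scale \<and> (\<exists>B. finite_dimensional_vector_space scale B)"

end

theory Submission
  imports
    Defs
    "HOL-Library.Ramsey"
    "Jordan_Normal_Form.Determinant"
begin

text \<open>
  By (V2) and (V3) each closed neighbourhood in the V-graph is, up to the identity coset, a subgroup
  of the quotient. Write \<open>z \<lless> c\<close> for \<open>1 - inverse c * z \<in> N\<close>, a rough form of \<open>v z > v c\<close>, and let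
  \<open>x\<close>, \<open>y\<close> represent cosets at distance at least 4. Looking for paths of length 3 gives transitivity
  rules such as \<open>a \<lless> n \<lless> b \<lless> m \<Longrightarrow> a \<lless> m\<close> for \<open>a \<in> x N\<close>, \<open>b \<in> y N\<close> and \<open>n, m \<in> N\<close>. Therefore
  the chains \<open>n \<lless> a \<lless> l \<lless> b \<lless> m\<close> define a bi-invariant strict order on \<open>N\<close>, and this order is total up
  to a bounded error. The additive group \<open>W\<close> generated by the elements of \<open>N\<close> below 1 is a bounded
  neighbourhood of 0 for a ring topology in which \<open>N\<close> is open and in which \<open>z\<close> or \<open>inverse z\<close> is
  bounded for every \<open>z\<close>.

  When the division ring has finite dimension \<open>d\<close> over its centre, the coordinates with respect to a
  basis are elementary operators \<open>\<Sum> a\<^sub>k z b\<^sub>k\<close>, hence continuous, and the determinant of left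
  multiplication agrees with the \<open>d\<close>-th power up to bounded factors. The elements whose determinant has
  bounded powers, measured against powers of one small central element, form an invariant valuation
  ring, and its valuation is the required one.
\<close>

subsection \<open>Adjacency of cosets and distance at least 4\<close>

text \<open>On \<open>N\<close> itself the relation \<open>\<lless>\<close> is symmetric, because
  \<open>- 1\<close> lies in \<open>N\<close>, so it orders nothing there. It is asymmetric between
  an element of \<open>N\<close> and an element of \<open>x N\<close> or \<open>y N\<close>; this is
  why comparisons inside \<open>N\<close> run through witnesses from both cosets. Each rule for such
  witnesses is proved by writing down the path that its failure would create. The longest paths have
  three edges, typically through \<open>a + b - m\<close> and \<open>a + b - n\<close>, and that is
  where the bound 4 comes from. The main obstacle is that \<open>\<prec>\<^sub>N\<close> is total
  only up to a factor. The finiteness of the index gives that much by the pigeonhole principle, but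
  \<open>W\<close> is then merely a bounded ring and not a valuation ring. Asking for all powers to
  be bounded removes the factor, yet this condition is not visibly stable under products of elements
  that do not commute. The norm avoids the difficulty: its values are central and it is invariant
  under conjugation. All bounds are finally expressed by powers of one central element
  \<open>c\<close>, so that the construction of the valuation ring becomes a comparison of
  exponents.\<close>

locale signed_normal_subgroup =
  fixes N :: "'a::division_ring set"
  assumes one_N [simp]: "1 \<in> N"
    and zero_N [simp]: "0 \<notin> N"
    and mult_N: "x \<in> N \<Longrightarrow> y \<in> N \<Longrightarrow> x * y \<in> N"
    and inverse_N: "x \<in> N \<Longrightarrow> inverse x \<in> N"
    and conj_N: "g \<noteq> 0 \<Longrightarrow> x \<in> N \<Longrightarrow> g * x * inverse g \<in> N"
    and neg_one_N [simp]: "- 1 \<in> N"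
begin

lemma neg_N_iff [simp]: "- x \<in> N \<longleftrightarrow> x \<in> N"
  using mult_N[OF neg_one_N, of x] mult_N[OF neg_one_N, of "- x"] by auto

lemma minus_N_commute: "x - y \<in> N \<longleftrightarrow> y - x \<in> N"
  using neg_N_iff[of "x - y"] by simp

lemma nonzero_N: "x \<in> N \<Longrightarrow> x \<noteq> 0"
  by auto

lemma inverse_N_iff [simp]: "inverse x \<in> N \<longleftrightarrow> x \<in> N"
  using inverse_N[of x] inverse_N[of "inverse x"] by auto

lemma mult_N_left_iff: "x \<in> N \<Longrightarrow> x * y \<in> N \<longleftrightarrow> y \<in> N"
  using mult_N[of x y] mult_N[of "inverse x" "x * y"] nonzero_N[of x]
  by (auto simp: mult.assoc[symmetric])

lemma conj_N_iff: "g \<noteq> 0 \<Longrightarrow> g * x * inverse g \<in> N \<longleftrightarrow> x \<in> N"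
  using conj_N[of g x] conj_N[of "inverse g" "g * x * inverse g"]
  by (auto simp: mult.assoc) (auto simp: mult.assoc[symmetric])

lemma conj_N_iff': "g \<noteq> 0 \<Longrightarrow> inverse g * x * g \<in> N \<longleftrightarrow> x \<in> N"
  using conj_N_iff[of "inverse g" x] by simp

lemma mult_N_commute: "x * y \<in> N \<longleftrightarrow> y * x \<in> N"
proof (cases "x = 0")
  case False
  then show ?thesis using conj_N_iff'[of x "x * y"] by (simp add: mult.assoc[symmetric])
qed simp

definition lcos :: "'a \<Rightarrow> 'a set" where
  "lcos g = {h. g \<noteq> 0 \<and> inverse g * h \<in> N}"

lemma lcos_refl: "g \<noteq> 0 \<Longrightarrow> g \<in> lcos g"
  by (simp add: lcos_def)

lemma lcos_nonzero: "h \<in> lcos g \<Longrightarrow> h \<noteq> 0"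
  by (auto simp: lcos_def)

lemma lcos_sym: "h \<in> lcos g \<Longrightarrow> g \<in> lcos h"
proof -
  assume h: "h \<in> lcos g"
  then have "inverse h * g = inverse (inverse g * h)"
    using lcos_nonzero[OF h] by (simp add: lcos_def nonzero_inverse_mult_distrib)
  then have "inverse h * g \<in> N" using h by (simp add: lcos_def)
  then show ?thesis using lcos_nonzero[OF h] by (simp add: lcos_def)
qed

lemma lcos_trans: "h \<in> lcos g \<Longrightarrow> k \<in> lcos h \<Longrightarrow> k \<in> lcos g"
proof -
  assume *: "h \<in> lcos g" "k \<in> lcos h"
  then have "(inverse g * h) * (inverse h * k) \<in> N" by (auto simp: lcos_def intro!: mult_N[of "inverse g * h"])
  moreover have "h * (inverse h * k) = k"
    using lcos_nonzero[OF *(1)] by (simp add: mult.assoc[symmetric])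
  ultimately show ?thesis using * by (simp add: lcos_def mult.assoc)
qed

lemma lcos_mult_right: "g \<noteq> 0 \<Longrightarrow> n \<in> N \<Longrightarrow> g * n \<in> lcos g"
  by (simp add: lcos_def mult.assoc[symmetric])

lemma lcos_mult_left: "g \<noteq> 0 \<Longrightarrow> n \<in> N \<Longrightarrow> n * g \<in> lcos g"
  using conj_N_iff'[of g n] by (simp add: lcos_def mult.assoc[symmetric])

lemma lcos_neg: "h \<in> lcos g \<Longrightarrow> - h \<in> lcos g"
  by (simp add: lcos_def)

lemma lcos_N: "n \<in> N \<Longrightarrow> h \<in> lcos n \<longleftrightarrow> h \<in> N"
  using nonzero_N[of n] by (simp add: lcos_def mult_N_left_iff)

lemma lcos_not_N: "g \<notin> N \<Longrightarrow> h \<in> lcos g \<Longrightarrow> h \<notin> N"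
  by (metis lcos_N lcos_sym)

text \<open>Subtracting \<open>z\<close> does not move \<open>c\<close> out of its coset. At
  \<open>c = 0\<close> the relation holds for every \<open>z\<close>, because
  \<open>inverse 0 = 0\<close>.\<close>

definition below :: "'a \<Rightarrow> 'a \<Rightarrow> bool"  (infix "\<lless>" 50) where
  "z \<lless> c \<longleftrightarrow> 1 - inverse c * z \<in> N"

lemma below_N: "n \<in> N \<Longrightarrow> z \<lless> n \<longleftrightarrow> n - z \<in> N"
  using mult_N_left_iff[of n "1 - inverse n * z"] nonzero_N[of n]
  by (simp add: below_def right_diff_distrib mult.assoc[symmetric])

lemma below_lcos: "c \<noteq> 0 \<Longrightarrow> z \<lless> c \<longleftrightarrow> c - z \<in> lcos c"
  by (simp add: below_def lcos_def right_diff_distrib)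

lemma below_mult_left: "g \<noteq> 0 \<Longrightarrow> g * z \<lless> g * c \<longleftrightarrow> z \<lless> c"
  by (cases "c = 0") (simp_all add: below_def nonzero_inverse_mult_distrib mult.assoc,
    metis mult.assoc mult_1_left left_inverse)

lemma below_mult_right: 
  assumes "g \<noteq> 0" shows "z * g \<lless> c * g \<longleftrightarrow> z \<lless> c"
proof (cases "c = 0")
  case False
  have "1 - inverse (c * g) * (z * g) = inverse g * (1 - inverse c * z) * g"
    using assms False by (simp add: nonzero_inverse_mult_distrib algebra_simps)
  then show ?thesis using conj_N_iff'[OF assms] by (simp add: below_def)
qed (simp add: below_def)

text \<open>The two defining elements are conjugate by \<open>c\<close>. Inversion therefore
  reverses the relation, and each primed rule below is its partner applied to inverses.\<close>

lemma below_inverse: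
  assumes "z \<noteq> 0" "c \<noteq> 0" shows "inverse c \<lless> inverse z \<longleftrightarrow> z \<lless> c"
proof -
  have "1 - z * inverse c = c * (1 - inverse c * z) * inverse c"
    using assms by (simp add: algebra_simps) (simp add: mult.assoc[symmetric])
  then show ?thesis using conj_N_iff[OF assms(2)] assms by (simp add: below_def)
qed

end

section \<open>Adjacency of cosets and the paths excluded by distance 4\<close>

locale coset_graph = signed_normal_subgroup +
  fixes E :: "'a \<Rightarrow> 'a \<Rightarrow> bool"
  assumes E_dest: "E g h \<Longrightarrow> g \<noteq> 0 \<and> g \<notin> N \<and> h \<noteq> 0 \<and> h \<notin> N"
    and E_refl: "g \<noteq> 0 \<Longrightarrow> g \<notin> N \<Longrightarrow> E g g"
    and E_sym: "E g h \<Longrightarrow> E h g"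
    and E_lcos: "E g h \<Longrightarrow> h' \<in> lcos h \<Longrightarrow> E g h'"
    and E_diff: "g \<noteq> 0 \<Longrightarrow> g \<notin> N \<Longrightarrow> h \<noteq> 0 \<Longrightarrow> h \<notin> N \<Longrightarrow> g - h \<in> N \<Longrightarrow> E g h"
    and E_inverse: "E g h \<Longrightarrow> E (inverse g) h"
    and E_mult: "b \<noteq> 0 \<Longrightarrow> b \<notin> N \<Longrightarrow> E a c \<Longrightarrow> E (a * b) c \<Longrightarrow> E b c"
begin

lemma E_lcos_left: "E g h \<Longrightarrow> g' \<in> lcos g \<Longrightarrow> E g' h"
  using E_lcos E_sym by blast

text \<open>\<open>E\<close> stands for distance at most 1 and is reflexive on vertices, so shorter
  paths are excluded together with those of three edges.\<close>

definition far :: "'a \<Rightarrow> 'a \<Rightarrow> bool" where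
  "far a b \<longleftrightarrow> a \<noteq> 0 \<and> a \<notin> N \<and> b \<noteq> 0 \<and> b \<notin> N \<and> \<not> (\<exists>p q. E a p \<and> E p q \<and> E q b)"

lemma far_nonzero: "far a b \<Longrightarrow> a \<noteq> 0 \<and> a \<notin> N \<and> b \<noteq> 0 \<and> b \<notin> N"
  by (simp add: far_def)

lemma far_3: "far a b \<Longrightarrow> E a p \<Longrightarrow> E p q \<Longrightarrow> E q b \<Longrightarrow> False"
  by (auto simp: far_def)

lemma far_2: "far a b \<Longrightarrow> E a p \<Longrightarrow> E p b \<Longrightarrow> False"
  using far_3[of a b p b] far_nonzero[of a b] E_refl[of b] by blast

lemma far_1: "far a b \<Longrightarrow> E a b \<Longrightarrow> False"
  using far_2[of a b b] far_nonzero[of a b] E_refl[of b] by blast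

lemma far_sym: "far a b \<Longrightarrow> far b a"
  unfolding far_def using E_sym by blast

lemma far_lcos: "far a b \<Longrightarrow> a' \<in> lcos a \<Longrightarrow> b' \<in> lcos b \<Longrightarrow> far a' b'"
  unfolding far_def by (metis E_lcos E_lcos_left lcos_sym lcos_N lcos_nonzero)

lemma far_inverse: "far a b \<Longrightarrow> far (inverse a) (inverse b)"
  unfolding far_def
  by (metis E_inverse E_sym inverse_N_iff inverse_inverse_eq nonzero_imp_inverse_nonzero)

lemma E_sum: "g \<noteq> 0 \<Longrightarrow> g \<notin> N \<Longrightarrow> h \<noteq> 0 \<Longrightarrow> h \<notin> N \<Longrightarrow> g + h \<in> N \<Longrightarrow> E g h"
  using E_diff[of g "- h"] E_lcos[of g "- h" h] lcos_neg[OF lcos_refl, of "- h"] by simp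

lemma far_not_lcos: "far a b \<Longrightarrow> b \<in> lcos a \<Longrightarrow> False"
  using far_1[of a b] E_lcos[of a a b] E_refl[of a] far_nonzero[of a b] by blast

text \<open>A failure makes \<open>m - a\<close> a vertex adjacent to \<open>a\<close>, because the
  two add up to \<open>m\<close>. Depending on \<open>m - n\<close>, one of two paths of three edges
  then joins \<open>a\<close> to \<open>b\<close>.\<close>

lemma far_below:
  assumes f: "far a b" and N: "n \<in> N" "m \<in> N"
    and "a \<lless> n" "n \<lless> b" "b \<lless> m"
  shows "a \<lless> m"
proof (rule ccontr)
  assume "\<not> a \<lless> m"
  then have na: "n - a \<in> N" and nb: "b - n \<in> lcos b" and mb: "m - b \<in> N" and ma: "m - a \<notin> N"
    using assms far_nonzero[OF f] by (auto simp: below_N below_lcos)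
  note nz = far_nonzero[OF f]
  have ma0: "m - a \<noteq> 0" using N nz by auto
  have nb': "b - n \<noteq> 0" "b - n \<notin> N" using nb lcos_nonzero lcos_not_N nz by blast+
  have e1: "E a (m - a)" using nz ma ma0 N by (intro E_sum) auto
  show False
  \<comment> \<open>If \<open>m - n\<close> is a vertex, the path is \<open>a\<close>,
    \<open>m - a\<close>, \<open>m - n\<close>, \<open>b - n\<close>, and the last one lies in the
    coset of \<open>b\<close>. Otherwise it is \<open>a\<close>, \<open>a + b - m\<close>,
    \<open>a + b - n\<close>, \<open>b\<close>, whose successive differences are, up to sign,
    \<open>m - b\<close>, \<open>n - m\<close> and \<open>n - a\<close>. A middle term that is zero
    or in \<open>N\<close> would give an even shorter path.\<close>
  proof (cases "m - n \<in> N")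
    case False
    have k0: "m - n \<noteq> 0" using na ma by auto
    have "E (m - a) (m - n)" using ma ma0 k0 False na by (intro E_diff) auto
    moreover have "E (m - n) (b - n)" using k0 False nb' mb by (intro E_diff) auto
    then have "E (m - n) b" using E_lcos lcos_sym[OF nb] by blast
    ultimately show False using far_3[OF f e1] by blast
  next
    case True
    have c1: "a + b - n \<noteq> 0"
    proof
      assume "a + b - n = 0"
      then have "a = - (b - n)" by (simp add: algebra_simps)
      then have "a \<in> lcos b" using lcos_neg[OF nb] by simp
      then show False using far_not_lcos[OF f] lcos_sym by blast
    qed
    have c1N: "a + b - n \<notin> N"
    proof
      assume "a + b - n \<in> N"
      then have "E a (b - n)" using nb' nz by (intro E_sum) (auto simp: algebra_simps)
      then show False using far_1[OF f] E_lcos lcos_sym[OF nb] by blast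
    qed
    have c2: "a + b - m \<noteq> 0"
    proof
      assume "a + b - m = 0"
      then have "b = m - a" by (simp add: algebra_simps)
      then show False using e1 far_1[OF f] by simp
    qed
    have c2N: "a + b - m \<notin> N"
    proof
      assume "a + b - m \<in> N"
      then have "b - (m - a) \<in> N" by (simp add: algebra_simps)
      then have "E (m - a) b" using ma ma0 nz E_diff[of b "m - a"] E_sym by blast
      then show False using far_2[OF f e1] by blast
    qed
    have "E a (a + b - m)" using nz c2 c2N mb by (intro E_diff) (auto simp: minus_N_commute[of b])
    moreover have "E (a + b - m) (a + b - n)"
      using c1 c2 c1N c2N True by (intro E_diff) (auto simp: minus_N_commute[of n])
    moreover have "E (a + b - n) b"
      using nz c1 c1N na by (intro E_diff) (auto simp: minus_N_commute[of a])
    ultimately show False using far_3[OF f] by blast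
  qed
qed

lemma far_below':
  assumes f: "far a b" and N: "n \<in> N" "m \<in> N" and l: "m \<lless> a" "a \<lless> n" "n \<lless> b"
  shows "m \<lless> b"
proof -
  note nz = far_nonzero[OF f]
  have "inverse b \<lless> inverse m"
    by (rule far_below[OF far_sym[OF far_inverse[OF f]], of "inverse n"])
      (use N nz l nonzero_N in \<open>auto simp: below_inverse\<close>)
  then show ?thesis using below_inverse[of m b] nz N nonzero_N by blast
qed

text \<open>If both alternatives fail, \<open>a\<close>, \<open>a + b - m\<close>,
  \<open>a + b - n\<close>, \<open>b\<close> is a path again, with \<open>n - m\<close> as its
  middle difference. The neighbours \<open>m - a\<close> of \<open>a\<close> and
  \<open>n - b\<close> of \<open>b\<close> show that the middle terms are vertices.\<close>

lemma far_below_cross: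
  assumes f: "far a b" and N: "n \<in> N" "m \<in> N" "n - m \<in> N" and l: "a \<lless> n" "b \<lless> m"
  shows "b \<lless> n \<or> a \<lless> m"
proof (rule ccontr)
  assume "\<not> ?thesis"
  then have na: "n - a \<in> N" and mb: "m - b \<in> N" and nb: "n - b \<notin> N" and ma: "m - a \<notin> N"
    using l N by (auto simp: below_N)
  note nz = far_nonzero[OF f]
  have nz2: "n - b \<noteq> 0" "m - a \<noteq> 0" using N nz by auto
  have e1: "E a (m - a)" using nz ma nz2 N by (intro E_sum) auto
  have e2: "E b (n - b)" using nz nb nz2 N by (intro E_sum) auto
  have c1: "a + b - n \<noteq> 0" "a + b - n \<notin> N"
  proof -
    show "a + b - n \<noteq> 0"
    proof
      assume "a + b - n = 0"
      then have "a = n - b" by (simp add: algebra_simps)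
      then show False using e2 far_1[OF far_sym[OF f]] by simp
    qed
    show "a + b - n \<notin> N"
    proof
      assume "a + b - n \<in> N"
      then have "a - (n - b) \<in> N" by (simp add: algebra_simps)
      then have "E (n - b) a" using nb nz2 nz E_diff[of a "n - b"] E_sym by blast
      then show False using far_2[OF far_sym[OF f] e2] by blast
    qed
  qed
  have c2: "a + b - m \<noteq> 0" "a + b - m \<notin> N"
  proof -
    show "a + b - m \<noteq> 0"
    proof
      assume "a + b - m = 0"
      then have "b = m - a" by (simp add: algebra_simps)
      then show False using e1 far_1[OF f] by simp
    qed
    show "a + b - m \<notin> N"
    proof
      assume "a + b - m \<in> N"
      then have "b - (m - a) \<in> N" by (simp add: algebra_simps)
      then have "E (m - a) b" using ma nz2 nz E_diff[of b "m - a"] E_sym by blast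
      then show False using far_2[OF f e1] by blast
    qed
  qed
  have "E a (a + b - m)" using nz c2 mb by (intro E_diff) (auto simp: minus_N_commute[of b])
  moreover have "E (a + b - m) (a + b - n)"
    using c1 c2 N(3) by (intro E_diff) auto
  moreover have "E (a + b - n) b"
    using nz c1 na by (intro E_diff) (auto simp: minus_N_commute[of a])
  ultimately show False using far_3[OF f] by blast
qed

lemma far_below_cross':
  assumes f: "far a b" and N: "n \<in> N" "m \<in> N" "n - m \<in> N" and l: "n \<lless> a" "m \<lless> b"
  shows "n \<lless> b \<or> m \<lless> a"
proof -
  note nz = far_nonzero[OF f]
  have n0: "n \<noteq> 0" "m \<noteq> 0" using N nonzero_N by auto
  have "inverse n - inverse m = - (inverse n * (n - m) * inverse m)"
    using n0 by (simp add: algebra_simps)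
  then have d: "inverse n - inverse m \<in> N"
    using N mult_N[OF mult_N[of "inverse n" "n - m"], of "inverse m"] by simp
  have "inverse b \<lless> inverse n \<or> inverse a \<lless> inverse m"
    by (rule far_below_cross[OF far_inverse[OF f]])
      (use N nz l n0 d in \<open>auto simp: below_inverse\<close>)
  then show ?thesis using below_inverse nz n0 by blast
qed

text \<open>Otherwise \<open>m - n\<close> is a vertex. It is adjacent to \<open>a - n\<close>,
  hence to \<open>a\<close>, and also to \<open>n - b\<close>, which is adjacent to
  \<open>b\<close>.\<close>

lemma far_below_diff:
  assumes f: "far a b" and N: "n \<in> N" "m \<in> N"
    and l: "n \<lless> a" "a \<lless> m" "b \<lless> m" "\<not> b \<lless> n"
  shows "m - n \<in> N"
proof (rule ccontr)
  assume k: "m - n \<notin> N"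
  note nz = far_nonzero[OF f]
  have an: "a - n \<in> lcos a" and ma: "m - a \<in> N" and mb: "m - b \<in> N" and nb: "n - b \<notin> N"
    using l N nz by (auto simp: below_N below_lcos)
  have k0: "m - n \<noteq> 0" using mb nb by auto
  have "a - n \<noteq> 0" "a - n \<notin> N" using an lcos_nonzero lcos_not_N nz by blast+
  then have "E (m - n) (a - n)" using k0 k ma by (intro E_diff) auto
  then have "E a (m - n)" using E_lcos lcos_sym[OF an] E_sym by blast
  moreover have bn: "n - b \<noteq> 0" using nz N by auto
  then have "E (m - n) (n - b)"
    using k k0 nb mb by (intro E_sum) (auto simp: algebra_simps)
  moreover have "E (n - b) b" using bn nb nz N by (intro E_sum) auto
  ultimately show False using far_3[OF f] by blast
qed

text \<open>An ultrametric law without any loss. Failures give paths of two edges, through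
  \<open>m - b\<close> (or \<open>m - a\<close>) in one direction and through
  \<open>m - (a + b)\<close> in the other. This exactness is what later permits sums of arbitrary
  length.\<close>

lemma far_below_sum:
  assumes f: "far a b" and m: "m \<in> N"
  shows "a + b \<lless> m \<longleftrightarrow> a \<lless> m \<and> b \<lless> m"
proof -
  have *: "b \<lless> m" if f: "far a b" and l: "a + b \<lless> m" for a b
  proof (rule ccontr)
    note nz = far_nonzero[OF f]
    assume "\<not> b \<lless> m"
    then have mb: "m - b \<notin> N" "m - b \<noteq> 0" using m nz by (auto simp: below_N)
    have ab: "m - (a + b) \<in> N" using l m by (simp add: below_N)
    have "E a (m - b)" using nz mb ab E_diff[of "m - b" a] E_sym by (auto simp: algebra_simps)
    moreover have "E (m - b) b" using nz mb m by (intro E_sum) auto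
    ultimately show False using far_2[OF f] by blast
  qed
  have "a + b \<lless> m" if l: "a \<lless> m" "b \<lless> m"
  proof (rule ccontr)
    assume "\<not> a + b \<lless> m"
    note nz = far_nonzero[OF f]
    from \<open>\<not> a + b \<lless> m\<close> have c: "m - (a + b) \<notin> N" using m by (simp add: below_N)
    have ma: "m - a \<in> N" and mb: "m - b \<in> N" using l m by (auto simp: below_N)
    have c0: "m - (a + b) \<noteq> 0"
    proof
      assume "m - (a + b) = 0"
      then have "m - a = b" by (simp add: algebra_simps)
      then show False using ma nz by simp
    qed
    have "E a (m - (a + b))"
      using nz c c0 mb E_sum[of a "m - (a + b)"] by (auto simp: algebra_simps)
    moreover have "E (m - (a + b)) b"
      using nz c c0 ma E_sum[of "m - (a + b)" b] by (auto simp: algebra_simps)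
    ultimately show False using far_2[OF f] by blast
  qed
  then show ?thesis using *[OF f] *[OF far_sym[OF f]] by (auto simp: add.commute)
qed

end

subsection \<open>The order on the subgroup\<close>

locale far_coset_graph = coset_graph +
  fixes x y :: 'a and F :: "'a set"
  assumes far_xy: "far x y"
    and N_diff: "\<exists>n\<in>N. \<exists>m\<in>N. z = n - m"
    and finite_F: "finite F"
    and F_cover: "z \<noteq> 0 \<Longrightarrow> \<exists>g\<in>F. z \<in> lcos g"
begin

lemma ex_above: "\<exists>n\<in>N. a \<lless> n"
proof -
  obtain n m where "n \<in> N" "m \<in> N" "a = n - m" using N_diff by blast
  then show ?thesis by (intro bexI[of _ n]) (auto simp: below_N)
qed

lemma ex_below: "a \<noteq> 0 \<Longrightarrow> \<exists>n\<in>N. n \<lless> a"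
  using ex_above[of "inverse a"] below_inverse[of "inverse _" a]
  by (metis inverse_N inverse_inverse_eq nonzero_N nonzero_imp_inverse_nonzero)

lemma far_X_Y: "a \<in> lcos x \<Longrightarrow> b \<in> lcos y \<Longrightarrow> far a b \<and> far b a"
  using far_lcos[OF far_xy] far_sym by blast

lemma X_nonzero: "a \<in> lcos x \<union> lcos y \<Longrightarrow> a \<noteq> 0 \<and> a \<notin> N"
  using far_nonzero[OF far_xy] lcos_nonzero lcos_not_N by blast

lemma below_asym: "n \<in> N \<Longrightarrow> a \<in> lcos x \<union> lcos y \<Longrightarrow> n \<lless> a \<Longrightarrow> \<not> a \<lless> n"
  using X_nonzero[of a] lcos_not_N[of a "a - n"] below_lcos[of a n]
  by (auto simp: below_N minus_N_commute)

definition prec :: "'a \<Rightarrow> 'a \<Rightarrow> bool"  (infix "\<prec>\<^sub>N" 50) where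
  "n \<prec>\<^sub>N m \<longleftrightarrow> n \<in> N \<and> m \<in> N \<and>
     (\<exists>a\<in>lcos x. \<exists>b\<in>lcos y. \<exists>l\<in>N. n \<lless> a \<and> a \<lless> l \<and> l \<lless> b \<and> b \<lless> m)"

lemma prec_N: "n \<prec>\<^sub>N m \<Longrightarrow> n \<in> N \<and> m \<in> N"
  by (simp add: prec_def)

text \<open>The two additional relations \<open>n \<lless> b\<close> and \<open>a \<lless> m\<close>
  separate \<open>n\<close> from \<open>m\<close> by an element of either coset. So whichever of
  \<open>x N\<close> and \<open>y N\<close> a given element belongs to, a witness far from it is at
  hand.\<close>

lemma precE:
  assumes "n \<prec>\<^sub>N m"
  obtains a b l where "n \<in> N" "m \<in> N" "l \<in> N" "a \<in> lcos x" "b \<in> lcos y"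
    "n \<lless> a" "a \<lless> l" "l \<lless> b" "b \<lless> m" "n \<lless> b" "a \<lless> m"
proof -
  obtain a b l where *: "n \<in> N" "m \<in> N" "l \<in> N" "a \<in> lcos x" "b \<in> lcos y"
    "n \<lless> a" "a \<lless> l" "l \<lless> b" "b \<lless> m"
    using assms unfolding prec_def by blast
  then have f: "far a b" using far_X_Y by blast
  show ?thesis
    using that[OF *] far_below[OF f *(3,2,7,8,9)] far_below'[OF f *(3,1,6,7,8)] by blast
qed

lemma below_prec:
  assumes "z \<in> lcos x \<union> lcos y" "z \<lless> n" "n \<prec>\<^sub>N m"
  shows "z \<lless> m"
proof -
  obtain a b l where *: "n \<in> N" "m \<in> N" "a \<in> lcos x" "b \<in> lcos y"
    "n \<lless> a" "b \<lless> m" "n \<lless> b" "a \<lless> m" using assms(3) by (rule precE)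
  show ?thesis
  proof (cases "z \<in> lcos x")
    case True
    then show ?thesis using far_below[of z b n m] far_X_Y * assms by blast
  next
    case False
    then show ?thesis using far_below[of z a n m] far_X_Y * assms by blast
  qed
qed

lemma prec_below:
  assumes "z \<in> lcos x \<union> lcos y" "n \<prec>\<^sub>N m" "m \<lless> z"
  shows "n \<lless> z"
proof -
  obtain a b l where *: "n \<in> N" "m \<in> N" "a \<in> lcos x" "b \<in> lcos y"
    "n \<lless> a" "b \<lless> m" "n \<lless> b" "a \<lless> m" using assms(2) by (rule precE)
  show ?thesis
  proof (cases "z \<in> lcos x")
    case True
    then show ?thesis using far_below'[of b z m n] far_X_Y * assms by blast
  next
    case False
    then show ?thesis using far_below'[of a z m n] far_X_Y * assms by blast
  qed
qed

lemma prec_trans: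
  assumes "n \<prec>\<^sub>N m" "m \<prec>\<^sub>N k" shows "n \<prec>\<^sub>N k"
proof -
  obtain a b l where *: "n \<in> N" "l \<in> N" "a \<in> lcos x" "b \<in> lcos y"
    "n \<lless> a" "a \<lless> l" "l \<lless> b" "b \<lless> m" using assms(1) by (rule precE)
  moreover have "b \<lless> k" using below_prec[of b m k] * assms(2) by blast
  ultimately show ?thesis unfolding prec_def using prec_N[OF assms(2)] by blast
qed

lemma prec_diff: 
  assumes "n \<prec>\<^sub>N m" shows "m - n \<in> N"
proof -
  obtain a b l where *: "n \<in> N" "m \<in> N" "a \<in> lcos x" "b \<in> lcos y"
    "n \<lless> a" "b \<lless> m" "n \<lless> b" "a \<lless> m" using assms by (rule precE)
  then have "\<not> b \<lless> n" using below_asym by blast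
  then show ?thesis using far_below_diff[of a b n m] * far_X_Y by blast
qed

lemma prec_irrefl: "\<not> n \<prec>\<^sub>N n"
  using prec_diff by force

lemma lcos_cong_left: "n \<in> N \<Longrightarrow> a \<in> lcos g \<Longrightarrow> n * a \<in> lcos g"
  using lcos_trans lcos_mult_left lcos_nonzero by blast

lemma lcos_cong_right: "n \<in> N \<Longrightarrow> a \<in> lcos g \<Longrightarrow> a * n \<in> lcos g"
  using lcos_trans lcos_mult_right lcos_nonzero by blast

lemma prec_mult_left: "k \<in> N \<Longrightarrow> n \<prec>\<^sub>N m \<Longrightarrow> k * n \<prec>\<^sub>N k * m"
  unfolding prec_def
  by (metis below_mult_left lcos_cong_left mult_N nonzero_N)

lemma prec_mult_right: "k \<in> N \<Longrightarrow> n \<prec>\<^sub>N m \<Longrightarrow> n * k \<prec>\<^sub>N m * k"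
  unfolding prec_def
  by (metis below_mult_right lcos_cong_right mult_N nonzero_N)

lemma prec_mult_left_iff: "k \<in> N \<Longrightarrow> k * n \<prec>\<^sub>N k * m \<longleftrightarrow> n \<prec>\<^sub>N m"
  using prec_mult_left[of k n m] prec_mult_left[of "inverse k" "k * n" "k * m"] nonzero_N[of k]
  by (auto simp: mult.assoc[symmetric])

lemma ex_prec: "\<exists>m. 1 \<prec>\<^sub>N m"
proof -
  note nz = far_nonzero[OF far_xy]
  obtain n where n: "n \<in> N" "n \<lless> x" using ex_below nz by blast
  obtain l where l: "l \<in> N" "x \<lless> l" using ex_above by blast
  obtain k where k: "k \<in> N" "k \<lless> y" using ex_below nz by blast
  \<comment> \<open>Multiplication by \<open>l * inverse k\<close> carries
    \<open>k \<lless> y\<close> to \<open>l \<lless> b\<close> and keeps the coset.\<close>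
  define b where "b = l * inverse k * y"
  have b: "b \<in> lcos y" "l \<lless> b"
    using l k nz lcos_cong_left[of "l * inverse k" y y] lcos_refl[of y] mult_N[of l "inverse k"]
      below_mult_left[of "l * inverse k" k y] nonzero_N[of l] nonzero_N[of k]
    by (auto simp: b_def mult.assoc)
  obtain m where m: "m \<in> N" "b \<lless> m" using ex_above by blast
  have "n \<prec>\<^sub>N m" unfolding prec_def using n l b m lcos_refl[of x] nz by blast
  then show ?thesis using prec_mult_left[of "inverse n" n m] n nonzero_N[of n] by auto
qed

text \<open>Translate the chain from \<open>n\<close> to \<open>m\<close> so that it starts at
  \<open>p\<close>, and ask whether \<open>m\<close> lies below the translate of \<open>a\<close>.
  Either answer rules out one alternative of a crossing rule, whose middle edge comes from
  \<open>p - n\<close> or \<open>p - m\<close>.\<close>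

lemma prec_total:
  assumes "n \<prec>\<^sub>N m" and p: "p \<in> N" "p - n \<in> N" "p - m \<in> N"
  shows "(\<forall>b\<in>lcos y. m \<lless> b \<longrightarrow> p \<lless> b) \<or> (\<forall>a\<in>lcos x. a \<lless> n \<longrightarrow> a \<lless> p)"
proof -
  obtain a b l where *: "n \<in> N" "m \<in> N" "l \<in> N" "a \<in> lcos x" "b \<in> lcos y"
    "n \<lless> a" "a \<lless> l" "l \<lless> b" "b \<lless> m" "n \<lless> b" "a \<lless> m" using assms(1) by (rule precE)
  define q where "q = p * inverse n"
  have q: "q \<in> N" "q \<noteq> 0" "q * n = p"
    using p * mult_N[of p "inverse n"] nonzero_N by (auto simp: q_def mult.assoc)
  have qa: "q * a \<in> lcos x" "p \<lless> q * a" "q * a \<lless> q * l"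
    using q * lcos_cong_left below_mult_left[OF q(2), of n a] below_mult_left[OF q(2), of a l]
    by auto
  have ql: "q * l \<in> N" using q * mult_N by blast
  show ?thesis
  proof (cases "m \<lless> q * a")
    case True
    have "b \<lless> q * l" using far_below[of b "q * a" m "q * l"] far_X_Y[OF qa(1) *(5)] * True qa ql by blast
    \<comment> \<open>Right translation by \<open>r\<close> sends \<open>l\<close> to
      \<open>n\<close> and \<open>q * l\<close> to \<open>p\<close>. As \<open>b\<close> is below
      \<open>q * l\<close> but not below \<open>l\<close>, the element \<open>b * r\<close> is below
      \<open>p\<close> but not below \<open>n\<close>.\<close>
    define r where "r = inverse l * n"
    have r: "r \<in> N" "r \<noteq> 0" "q * l * r = p" "l * r = n"
      using * q mult_N[of "inverse l" n] nonzero_N[of l] nonzero_N[of n]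
      by (auto simp: r_def mult.assoc) (simp_all add: mult.assoc[symmetric])
    have br: "b * r \<in> lcos y" "b * r \<lless> p" "\<not> b * r \<lless> n"
      using \<open>b \<lless> q * l\<close> r * lcos_cong_right below_mult_right[OF r(2), of b "q * l"]
        below_mult_right[OF r(2), of b l] below_asym[of l b] by auto
    have "a' \<lless> p" if "a' \<in> lcos x" "a' \<lless> n" for a'
      using far_below_cross[of a' "b * r" n p] far_X_Y[OF that(1) br(1)] that * p br
      by (auto simp: minus_N_commute[of n])
    then show ?thesis by blast
  next
    case False
    have "p \<lless> b'" if "b' \<in> lcos y" "m \<lless> b'" for b'
      using far_below_cross'[of "q * a" b' p m] far_X_Y[OF qa(1) that(1)] that * p qa False by auto
    then show ?thesis by blast
  qed
qed

text \<open>
  The closed neighbourhood of \<open>p - k\<close> is a subgroup; it contains \<open>p - z\<close> and also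
  \<open>inverse z * (p - z)\<close>, hence \<open>z\<close>.
\<close>

lemma E_same_lcos:
  assumes N: "p \<in> N" "k \<in> N" "l \<in> N" and z: "z \<noteq> 0" "z \<notin> N" "k \<lless> z" "z \<lless> l"
    and u: "p - k \<noteq> 0" "p - k \<notin> N" "p - l \<in> lcos (p - k)"
  shows "E (p - k) z"
proof -
  have zk: "z - k \<in> lcos z" and zl: "l - z \<in> N"
    using z N by (auto simp: below_lcos below_N)
  have zk': "z - k \<noteq> 0" "z - k \<notin> N" using zk lcos_nonzero lcos_not_N[OF z(2)] by blast+
  have pz: "p - z \<noteq> 0" using N z by auto
  show ?thesis
  proof (cases "p - z \<in> N")
    case True
    have "E (p - k) (z - k)" using u zk' True by (intro E_diff) auto
    then show ?thesis using E_lcos lcos_sym[OF zk] by blast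
  next
    case False
    have "E (p - l) (p - z)"
      using lcos_nonzero[OF u(3)] lcos_not_N[OF u(2,3)] pz False zl minus_N_commute[of z l]
      by (intro E_diff) auto
    then have e1: "E (p - z) (p - k)" using E_sym E_lcos lcos_sym[OF u(3)] by blast
    show ?thesis
    proof (cases "p \<lless> z")
      case True
      then have "p - z \<in> lcos z" using below_lcos[OF z(1), of p] lcos_neg[of "z - p" z] by simp
      then show ?thesis using E_lcos[OF E_sym[OF e1]] lcos_sym by blast
    next
      case nz: False
      note nonz = nonzero_N[OF N(1)] nonzero_N[OF N(2)] z(1)
      have i1: "inverse p - inverse z \<notin> N"
        using nz below_inverse[of p z] nonz N(1) by (simp add: below_N)
      have i2: "inverse k - inverse z \<in> N"
        using z(3) below_inverse[of k z] nonz N(2) by (simp add: below_N)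
      have i3: "inverse k - inverse p = inverse k * (p - k) * inverse p"
        using nonz by (simp add: algebra_simps)
      have i4: "inverse z - inverse p = inverse z * (p - z) * inverse p"
        using nonz by (simp add: algebra_simps)
      have c3: "inverse k - inverse p \<in> lcos (p - k)"
        unfolding i3 using N lcos_refl[OF u(1)] lcos_cong_left lcos_cong_right by auto
      have c4: "inverse z - inverse p \<in> lcos (inverse z * (p - z))"
        unfolding i4 using N nonz pz lcos_mult_right[of "inverse z * (p - z)" "inverse p"] by auto
      have "E (inverse k - inverse p) (inverse z - inverse p)"
        using lcos_nonzero[OF c3] lcos_not_N[OF u(2) c3] lcos_nonzero[OF c4] i1 i2
          minus_N_commute[of "inverse p"]
        by (intro E_diff) auto
      then have "E (inverse z * (p - z)) (p - k)"
        using E_lcos[OF E_sym] E_lcos_left[OF _ lcos_sym[OF c3]] E_sym lcos_sym[OF c4] E_lcos by blast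
      then have "E (inverse (p - z) * z) (p - k)"
        using E_inverse[of "inverse z * (p - z)"] nonz pz by (simp add: nonzero_inverse_mult_distrib)
      then have "E z (p - k)" using E_mult[OF z(1,2) E_inverse[OF e1]] by simp
      then show ?thesis by (rule E_sym)
    qed
  qed
qed

text \<open>Both witnesses between \<open>k\<close> and \<open>l\<close> would be adjacent to
  \<open>p - k\<close>, which gives a path of two edges. Hence along a
  \<open>\<prec>\<^sub>N\<close>-chain the differences from \<open>p\<close> that are vertices lie
  in distinct cosets.\<close>

lemma prec_same_lcos:
  assumes "k \<prec>\<^sub>N l" "p \<in> N" "p - k \<noteq> 0" "p - k \<notin> N" "p - l \<in> lcos (p - k)"
  shows False
proof -
  obtain a b where *: "k \<in> N" "l \<in> N" "a \<in> lcos x" "b \<in> lcos y"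
    "k \<lless> a" "b \<lless> l" "k \<lless> b" "a \<lless> l" using assms(1) by (rule precE)
  have "E (p - k) a" "E (p - k) b"
    using E_same_lcos[of p k l] * assms X_nonzero by blast+
  then show False using far_2[of a b "p - k"] far_X_Y * E_sym by blast
qed

text \<open>Together with \<open>prec_prec_below\<close>, this turns the one-sided comparisons
  supplied by \<open>prec_total\<close> into \<open>\<prec>\<^sub>N\<close>, at the cost of one
  further step of the order.\<close>

lemma below_prec_prec:
  assumes "p \<in> N" "b \<in> lcos y" "p \<lless> b" "b \<lless> m" "m \<prec>\<^sub>N k"
  shows "p \<prec>\<^sub>N k"
proof -
  obtain a' b' l where *: "m \<in> N" "k \<in> N" "l \<in> N" "a' \<in> lcos x" "b' \<in> lcos y"
    "m \<lless> a'" "a' \<lless> l" "l \<lless> b'" "b' \<lless> k" using assms(5) by (rule precE)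
  then have "p \<lless> a'" using far_below'[of b a' m p] far_X_Y assms by blast
  then show ?thesis unfolding prec_def using * assms by blast
qed

lemma prec_prec_below:
  assumes "p \<in> N" "a \<in> lcos x" "a \<lless> p" "m \<lless> a" "k \<prec>\<^sub>N m"
  shows "k \<prec>\<^sub>N p"
proof -
  obtain a' b' l where *: "m \<in> N" "k \<in> N" "l \<in> N" "a' \<in> lcos x" "b' \<in> lcos y"
    "k \<lless> a'" "a' \<lless> l" "l \<lless> b'" "b' \<lless> m" using assms(5) by (rule precE)
  then have "b' \<lless> p" using far_below[of b' a m p] far_X_Y assms by blast
  then show ?thesis unfolding prec_def using * assms by blast
qed

text \<open>Compare \<open>p\<close> with the powers of one \<open>\<kappa>\<close> above 1. By
  \<open>prec_same_lcos\<close> and the finite index, only boundedly many differences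
  \<open>p - \<kappa> ^ i\<close> miss \<open>N\<close>, and two that lie in \<open>N\<close>
  suffice for \<open>prec_total\<close>.\<close>

lemma prec_level: "\<exists>\<alpha>. 1 \<prec>\<^sub>N \<alpha> \<and> (\<forall>p\<in>N. p \<prec>\<^sub>N \<alpha> \<or> 1 \<prec>\<^sub>N p)"
proof -
  obtain \<kappa> where \<kappa>: "1 \<prec>\<^sub>N \<kappa>" using ex_prec by blast
  have pow_N: "\<kappa> ^ i \<in> N" for i
    by (induction i) (use prec_N[OF \<kappa>] in \<open>auto intro: mult_N\<close>)
  have step: "\<kappa> ^ i \<prec>\<^sub>N \<kappa> ^ Suc i" for i
    using prec_mult_right[OF pow_N \<kappa>, of i] by simp
  have less: "\<kappa> ^ i \<prec>\<^sub>N \<kappa> ^ j" if "i < j" for i j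
    using that by (induction rule: less_Suc_induct) (use step prec_trans in blast)+
  define c where "c = card F"
  \<comment> \<open>Of the \<open>c + 3\<close> exponents in \<open>{2..M}\<close> at most
    \<open>c + 1\<close> are bad: one for each element of \<open>F\<close> and one for a zero
    difference. Two good ones remain.\<close>
  define M where "M = c + 4"
  have "p \<prec>\<^sub>N \<kappa> ^ (M + 3) \<or> 1 \<prec>\<^sub>N p" if p: "p \<in> N" for p
  proof -
    define S where "S = {i \<in> {2..M}. p - \<kappa> ^ i \<notin> N}"
    \<comment> \<open>The default 0 cannot be confused with a representative, since
      \<open>lcos 0\<close> is empty.\<close>
    define h where "h i = (if p - \<kappa> ^ i = 0 then 0 else SOME g. g \<in> F \<and> p - \<kappa> ^ i \<in> lcos g)" for i
    have h: "h i \<in> F \<and> p - \<kappa> ^ i \<in> lcos (h i)" if "p - \<kappa> ^ i \<noteq> 0" for i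
      using someI_ex[of "\<lambda>g. g \<in> F \<and> p - \<kappa> ^ i \<in> lcos g"] F_cover[OF that] that
      by (auto simp: h_def)
    have "inj_on h S"
    proof (rule linorder_inj_onI')
      fix i j assume ij: "i \<in> S" "j \<in> S" "i < j"
      note k = less[OF ij(3)]
      show "h i \<noteq> h j"
      proof
        assume eq: "h i = h j"
        have "\<kappa> ^ i \<noteq> \<kappa> ^ j" using k prec_irrefl by metis
        then consider "p - \<kappa> ^ i = 0" "p - \<kappa> ^ j \<noteq> 0" | "p - \<kappa> ^ i \<noteq> 0" "p - \<kappa> ^ j = 0"
          | "p - \<kappa> ^ i \<noteq> 0" "p - \<kappa> ^ j \<noteq> 0" by fastforce
        then show False
        proof cases
          case 1
          then show False using h[of j] eq by (simp add: h_def[of i] lcos_def)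
        next
          case 2
          then show False using h[of i] eq by (simp add: h_def[of j] lcos_def)
        next
          case 3
          then have "p - \<kappa> ^ j \<in> lcos (p - \<kappa> ^ i)" using h eq lcos_sym lcos_trans by metis
          then show False using prec_same_lcos[OF k p] 3 ij by (auto simp: S_def)
        qed
      qed
    qed
    moreover have "h ` S \<subseteq> insert 0 F" using h by (auto simp: h_def)
    ultimately have "card S \<le> card (insert 0 F)" using card_inj_on_le finite_F by blast
    then have "card S \<le> c + 1" using card_insert_le_m1[of "c + 1" F 0] finite_F
      by (auto simp: c_def card_insert_if split: if_splits)
    moreover have "card ({2..M} - S) = card {2..M} - card S"
      by (intro card_Diff_subset) (auto simp: S_def)
    ultimately have "card ({2..M} - S) \<ge> 2" by (simp add: M_def)
    then obtain T where "T \<subseteq> {2..M} - S" "card T = 2" by (metis obtain_subset_with_card_n)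
    then obtain i j where ij: "i \<in> {2..M} - S" "j \<in> {2..M} - S" "i \<noteq> j"
      by (auto simp: card_2_iff)
    define i' j' where "i' = min i j" and "j' = max i j"
    have ij': "i' < j'" "2 \<le> i'" "j' \<le> M" "p - \<kappa> ^ i' \<in> N" "p - \<kappa> ^ j' \<in> N"
      using ij by (auto simp: i'_def j'_def S_def min_def max_def)
    from prec_total[OF less[OF ij'(1)] p ij'(4,5)] show ?thesis
    proof
      assume *: "\<forall>b\<in>lcos y. \<kappa> ^ j' \<lless> b \<longrightarrow> p \<lless> b"
      obtain b where b: "b \<in> lcos y" "\<kappa> ^ j' \<lless> b" "b \<lless> \<kappa> ^ Suc j'"
        using step[of j'] by (rule precE)
      have "p \<prec>\<^sub>N \<kappa> ^ (M + 3)"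
        using below_prec_prec[OF p b(1) _ b(3) less] * b ij' by auto
      then show ?thesis by blast
    next
      assume *: "\<forall>a\<in>lcos x. a \<lless> \<kappa> ^ i' \<longrightarrow> a \<lless> p"
      \<comment> \<open>Exponents start at 2 because two powers are spent: one for the witness
        \<open>a\<close> below \<open>\<kappa> ^ i'\<close>, one for the step of the order required
        by \<open>prec_prec_below\<close>.\<close>
      obtain i'' where i'': "i' = Suc (Suc i'')" using ij'(2) by (metis Suc_le_D numeral_2_eq_2 Suc_le_mono)
      obtain a where a: "a \<in> lcos x" "\<kappa> ^ Suc i'' \<lless> a" "a \<lless> \<kappa> ^ i'"
        using step[of "Suc i''"] unfolding i'' by (rule precE)
      have "\<kappa> ^ i'' \<prec>\<^sub>N p"
        using prec_prec_below[OF p a(1) _ a(2) step] * a by blast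
      moreover have "i'' = 0 \<or> 1 \<prec>\<^sub>N \<kappa> ^ i''" using less[of 0 i''] by auto
      ultimately show ?thesis using prec_trans by auto
    qed
  qed
  moreover have "1 \<prec>\<^sub>N \<kappa> ^ (M + 3)" using less[of 0 "M + 3"] by simp
  ultimately show ?thesis by blast
qed

end

subsection \<open>The ring topology\<close>

context signed_normal_subgroup
begin

text \<open>Ramsey's theorem with the coset of \<open>s - t\<close> as the colour of the pair. Left
  multiplication by \<open>z * inverse g\<close> then moves the monochromatic coset of
  \<open>g\<close> to that of \<open>z\<close>.\<close>

lemma infinite_same_coset_differences:
  assumes F: "finite F" "\<And>z. z \<noteq> 0 \<Longrightarrow> \<exists>g\<in>F. z \<in> lcos g" and inf: "infinite (UNIV :: 'a set)"
    and z: "z \<noteq> 0"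
  shows "\<exists>T. infinite T \<and> (\<forall>s\<in>T. \<forall>t\<in>T. s \<noteq> t \<longrightarrow> s - t \<in> lcos z)"
proof -
  obtain h where h: "bij_betw h F {0..<card F}" using ex_bij_betw_finite_nat[OF F(1)] by blast
  \<comment> \<open>Colours belong to unordered pairs; this is consistent because
    \<open>s - t\<close> and \<open>t - s\<close> share a coset, \<open>- 1\<close> being in
    \<open>N\<close>.\<close>
  define rep where "rep X = (SOME g. g \<in> F \<and> (\<exists>s t. X = {s, t} \<and> s \<noteq> t \<and> s - t \<in> lcos g))" for X
  have rep: "rep {s, t} \<in> F \<and> s - t \<in> lcos (rep {s, t})" if "s \<noteq> t" for s t
  proof -
    obtain g where "g \<in> F" "s - t \<in> lcos g" using F(2)[of "s - t"] \<open>s \<noteq> t\<close> by auto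
    then have "\<exists>g. g \<in> F \<and> (\<exists>s' t'. {s, t} = {s', t'} \<and> s' \<noteq> t' \<and> s' - t' \<in> lcos g)"
      using that by blast
    from someI_ex[OF this] obtain s' t' where *: "rep {s, t} \<in> F" "{s, t} = {s', t'}"
        "s' - t' \<in> lcos (rep {s, t})"
      unfolding rep_def by blast
    then have "s = s' \<and> t = t' \<or> s = t' \<and> t = s'" by (auto simp: doubleton_eq_iff)
    then show ?thesis using * lcos_neg[OF *(3)] by auto
  qed
  have "\<forall>x\<in>UNIV. \<forall>y\<in>UNIV. x \<noteq> y \<longrightarrow> h (rep {x, y}) < card F"
    using rep h by (auto simp: bij_betw_def)
  from Ramsey2[OF inf this] obtain Y c where Y: "infinite Y"
    "\<forall>x\<in>Y. \<forall>y\<in>Y. x \<noteq> y \<longrightarrow> h (rep {x, y}) = c" by blast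
  obtain s0 t0 where st0: "s0 \<in> Y" "t0 \<in> Y" "s0 \<noteq> t0"
    using Y(1) by (metis finite.simps finite_subset insertI1 insertI2 subsetI singletonI)
  define g where "g = rep {s0, t0}"
  have g: "s - t \<in> lcos g" if "s \<in> Y" "t \<in> Y" "s \<noteq> t" for s t
    using rep[OF that(3)] rep[OF st0(3)] Y(2) that st0 h
    unfolding g_def by (metis bij_betw_imp_inj_on inj_on_eq_iff)
  have g0: "g \<noteq> 0" using g[OF st0] by (auto simp: lcos_def)
  define k where "k = z * inverse g"
  have k: "k \<noteq> 0" "k * g = z" using z g0 by (auto simp: k_def mult.assoc)
  show ?thesis
  proof (intro exI[of _ "(*) k ` Y"] conjI ballI impI)
    show "infinite ((*) k ` Y)" using Y(1) k by (simp add: finite_image_iff inj_on_def)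
    fix s t assume "s \<in> (*) k ` Y" "t \<in> (*) k ` Y" "s \<noteq> t"
    then obtain s' t' where *: "s' \<in> Y" "t' \<in> Y" "s' \<noteq> t'" "s = k * s'" "t = k * t'" by auto
    have "inverse z * (s - t) = inverse g * (s' - t')"
      using k g0 z unfolding * by (simp add: k_def nonzero_inverse_mult_distrib algebra_simps)
        (simp add: mult.assoc[symmetric])
    then show "s - t \<in> lcos z" using g[OF *(1-3)] z by (simp add: lcos_def)
  qed
qed

text \<open>If \<open>z\<close> is no difference of elements of \<open>N\<close>, neither is any
  element of its coset, so differences within the set \<open>T\<close> from the Ramsey argument are
  none either. Translates by \<open>T\<close> can therefore be used to avoid one coset after
  another, until only 0 is left.\<close>

lemma difference_of_N:
  assumes F: "finite F" "\<And>z. z \<noteq> 0 \<Longrightarrow> \<exists>g\<in>F. z \<in> lcos g" and inf: "infinite (UNIV :: 'a set)"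
  shows "\<exists>n\<in>N. \<exists>m\<in>N. z = n - m"
proof (rule ccontr)
  assume neg: "\<not> ?thesis"
  then have z: "z \<noteq> 0" using one_N by force
  obtain T where T: "infinite T" "\<And>s t. s \<in> T \<Longrightarrow> t \<in> T \<Longrightarrow> s \<noteq> t \<Longrightarrow> s - t \<in> lcos z"
    using infinite_same_coset_differences[OF F inf z] by blast
  have disj: "n - m \<noteq> s - t" if "s \<in> T" "t \<in> T" "s \<noteq> t" "n \<in> N" "m \<in> N" for n m s t
  proof
    assume eq: "n - m = s - t"
    define k where "k = inverse z * (s - t)"
    have k: "k \<in> N" "k \<noteq> 0" using T(2)[OF that(1-3)] nonzero_N[of k] by (auto simp: lcos_def k_def)
    have "z * k = n - m" using z eq by (simp add: k_def mult.assoc[symmetric])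
    then have "z = n * inverse k - m * inverse k"
      using k by (metis left_diff_distrib mult.assoc mult.right_neutral right_inverse)
    moreover have "n * inverse k \<in> N" "m * inverse k \<in> N"
      using that k by (auto intro: mult_N)
    ultimately show False using neg by blast
  qed
  have avoid: "\<exists>S. finite S \<and> (\<forall>z0. \<exists>s\<in>S. \<forall>g\<in>G. z0 + s \<notin> lcos g)" if "finite G" for G
    using that
  proof (induction G)
    case empty
    then show ?case by (intro exI[of _ "{0}"]) auto
  next
    case (insert g G)
    then obtain S where S: "finite S" "\<And>z0. \<exists>s\<in>S. \<forall>g\<in>G. z0 + s \<notin> lcos g" by blast
    \<comment> \<open>One element more than \<open>S\<close> has: two translates
      \<open>g * t\<close> and \<open>g * t'\<close> must then use the same correction from
      \<open>S\<close>. If both sums lay in the coset of \<open>g\<close>, then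
      \<open>t - t'\<close> would be a difference of elements of \<open>N\<close>.\<close>
    obtain T' where T': "T' \<subseteq> T" "finite T'" "card T' = Suc (card S)"
      using infinite_arbitrarily_large[OF T(1)] by blast
    define S' where "S' = (\<lambda>(t, s). g * t + s) ` (T' \<times> S)"
    show ?case
    proof (intro exI[of _ S'] conjI allI)
      show "finite S'" using S T' by (simp add: S'_def)
      fix z0
      have "\<forall>t\<in>T'. \<exists>s\<in>S. \<forall>h\<in>G. z0 + g * t + s \<notin> lcos h" using S(2) by blast
      then obtain \<sigma> where \<sigma>: "\<And>t. t \<in> T' \<Longrightarrow> \<sigma> t \<in> S"
          "\<And>t h. t \<in> T' \<Longrightarrow> h \<in> G \<Longrightarrow> z0 + g * t + \<sigma> t \<notin> lcos h" by metis
      have "card (\<sigma> ` T') < card T'"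
        using \<sigma>(1) T' S(1) card_mono[of S "\<sigma> ` T'"] by (auto simp: image_subset_iff)
      then have "\<not> inj_on \<sigma> T'" by (rule pigeonhole)
      then obtain t t' where tt: "t \<in> T'" "t' \<in> T'" "t \<noteq> t'" "\<sigma> t = \<sigma> t'"
        by (auto simp: inj_on_def)
      have "z0 + g * t + \<sigma> t \<notin> lcos g \<or> z0 + g * t' + \<sigma> t' \<notin> lcos g"
      proof (rule ccontr)
        assume "\<not> ?thesis"
        then have a: "g \<noteq> 0" "inverse g * (z0 + g * t + \<sigma> t) \<in> N"
            "inverse g * (z0 + g * t' + \<sigma> t') \<in> N" by (auto simp: lcos_def)
        have "inverse g * (z0 + g * t + \<sigma> t) - inverse g * (z0 + g * t' + \<sigma> t') = t - t'"
          using a(1) tt(4) by (simp add: algebra_simps) (simp add: mult.assoc[symmetric])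
        then show False using disj[OF _ _ tt(3) a(2,3)] tt T' by auto
      qed
      then obtain t where "t \<in> T'" "\<forall>h\<in>insert g G. z0 + g * t + \<sigma> t \<notin> lcos h"
        using \<sigma>(2) tt by blast
      then show "\<exists>s\<in>S'. \<forall>h\<in>insert g G. z0 + s \<notin> lcos h"
        using \<sigma>(1) by (intro bexI[of _ "g * t + \<sigma> t"]) (auto simp: S'_def add.assoc)
    qed
  qed
  from avoid[OF F(1)] obtain S where S: "finite S" "\<And>z0. \<exists>s\<in>S. \<forall>g\<in>F. z0 + s \<notin> lcos g" by blast
  have "z0 \<in> uminus ` S" for z0
  proof -
    obtain s where "s \<in> S" "\<forall>g\<in>F. z0 + s \<notin> lcos g" using S(2) by blast
    moreover from this have "z0 + s = 0" using F(2) by blast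
    ultimately show ?thesis by (auto simp: eq_neg_iff_add_eq_0)
  qed
  then have "UNIV \<subseteq> uminus ` S" by blast
  then show False using S(1) inf finite_subset by blast
qed

end

section \<open>The bounded ring \<open>W\<close> and bounds relative to elements of
  \<open>N\<close>\<close>

context far_coset_graph
begin

inductive_set W :: "'a set" where
  W_0 [simp]: "0 \<in> W"
| W_add: "w \<in> W \<Longrightarrow> r \<prec>\<^sub>N 1 \<Longrightarrow> w + r \<in> W"
| W_sub: "w \<in> W \<Longrightarrow> r \<prec>\<^sub>N 1 \<Longrightarrow> w - r \<in> W"

lemma W_gen: "r \<prec>\<^sub>N 1 \<Longrightarrow> r \<in> W"
  using W_add[of 0 r] by simp

lemma W_plus: "w \<in> W \<Longrightarrow> v \<in> W \<Longrightarrow> w + v \<in> W"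
proof (induction rule: W.induct)
  case (W_add w r)
  then show ?case using W.W_add[of "w + v" r] by (simp add: algebra_simps)
next
  case (W_sub w r)
  then show ?case using W.W_sub[of "w + v" r] by (simp add: algebra_simps)
qed simp

lemma W_uminus: "w \<in> W \<Longrightarrow> - w \<in> W"
proof (induction rule: W.induct)
  case (W_add w r)
  then show ?case using W.W_sub[of "- w" r]
    by (simp only: minus_add_distrib diff_conv_add_uminus minus_minus)
next
  case (W_sub w r)
  then show ?case using W.W_add[of "- w" r]
    by (simp only: minus_add_distrib diff_conv_add_uminus minus_minus)
qed simp

lemma W_induct_mult:
  assumes "\<And>r. r \<prec>\<^sub>N 1 \<Longrightarrow> u * r * v \<in> W" "w \<in> W"
  shows "u * w * v \<in> W"
  using assms(2)
proof (induction rule: W.induct)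
  case (W_add w r)
  then show ?case using assms(1)[of r] W_plus by (simp add: algebra_simps)
next
  case (W_sub w r)
  then show ?case using assms(1)[of r] W_plus[OF _ W_uminus, of "u * w * v" "u * r * v"]
    by (simp add: algebra_simps)
qed simp

lemma W_conj:
  assumes n: "n \<in> N" and "w \<in> W" shows "n * w * inverse n \<in> W"
proof (rule W_induct_mult[OF W_gen assms(2)])
  fix r assume r: "r \<prec>\<^sub>N 1"
  have "n * r * inverse n \<prec>\<^sub>N n * 1 * inverse n"
    using r n by (intro prec_mult_left prec_mult_right) auto
  then show "n * r * inverse n \<prec>\<^sub>N 1" using nonzero_N[OF n] by simp
qed

lemma W_mult_gen: "r \<prec>\<^sub>N 1 \<Longrightarrow> w \<in> W \<Longrightarrow> w * r \<in> W"
  using W_induct_mult[of 1 r w] prec_mult_right[of r _ 1] prec_trans prec_N W_gen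
  by (metis mult_1_left)

lemma W_mult: "v \<in> W \<Longrightarrow> w \<in> W \<Longrightarrow> w * v \<in> W"
proof (induction rule: W.induct)
  case (W_add v r)
  then show ?case using W_plus W_mult_gen[of r w] by (simp add: algebra_simps)
next
  case (W_sub v r)
  then show ?case using W_plus[OF _ W_uminus] W_mult_gen[of r w] 
    by (metis diff_conv_add_uminus right_diff_distrib)
qed simp

text \<open>A rough form of \<open>v z \<ge> v n\<close>. Since \<open>W\<close> is stable under
  conjugation by \<open>N\<close>, the side on which \<open>n\<close> is divided off does not
  matter.\<close>

definition small :: "'a \<Rightarrow> 'a \<Rightarrow> bool" where
  "small z n \<longleftrightarrow> n \<in> N \<and> z * inverse n \<in> W"

lemma small_N: "small z n \<Longrightarrow> n \<in> N"
  by (simp add: small_def)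

lemma small_1: "small z 1 \<longleftrightarrow> z \<in> W"
  by (simp add: small_def)

lemma small_0: "n \<in> N \<Longrightarrow> small 0 n"
  by (simp add: small_def)

lemma small_add: "small z n \<Longrightarrow> small w n \<Longrightarrow> small (z + w) n"
  by (simp add: small_def distrib_right W_plus)

lemma small_uminus: "small z n \<Longrightarrow> small (- z) n"
  using W_uminus by (fastforce simp: small_def)

lemma small_diff: "small z n \<Longrightarrow> small w n \<Longrightarrow> small (z - w) n"
  using small_add[OF _ small_uminus] by fastforce

lemma small_mono:
  assumes "small z n" "n \<prec>\<^sub>N m" shows "small z m"
proof -
  have nm: "n \<in> N" "m \<in> N" using prec_N assms by blast+
  then have "n * inverse m \<prec>\<^sub>N 1"
    using prec_mult_right[OF _ assms(2), of "inverse m"] nonzero_N[of m] by simp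
  then have "(z * inverse n) * (n * inverse m) \<in> W" using W_mult_gen[of "n * inverse m" "z * inverse n"] assms(1) by (simp add: small_def)
  moreover have "(z * inverse n) * (n * inverse m) = z * inverse m"
    using nonzero_N[OF nm(1)] by (simp add: mult.assoc[symmetric]) (simp add: mult.assoc)
  ultimately show ?thesis using nm by (simp add: small_def)
qed

lemma small_mult:
  assumes "small z n" "small w m" shows "small (z * w) (n * m)"
proof -
  have nm: "n \<in> N" "m \<in> N" using assms by (auto simp: small_def)
  have "(z * inverse n) * (n * (w * inverse m) * inverse n) \<in> W"
    by (rule W_mult[OF W_conj[OF nm(1)]]) (use assms in \<open>simp_all add: small_def\<close>)
  moreover have "(z * inverse n) * (n * (w * inverse m) * inverse n) = z * w * inverse (n * m)"
    using nonzero_N[OF nm(1)] nonzero_N[OF nm(2)]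
    by (simp add: nonzero_inverse_mult_distrib mult.assoc)
      (metis mult.assoc mult_1_left left_inverse)
  ultimately show ?thesis using nm mult_N by (simp add: small_def)
qed

lemma small_gen: "r \<prec>\<^sub>N m \<Longrightarrow> small r m"
  using prec_mult_right[of "inverse m" r m] prec_N[of r m] nonzero_N[of m] W_gen
  by (auto simp: small_def)

lemma prec_inverse_1: "1 \<prec>\<^sub>N n \<Longrightarrow> inverse n \<prec>\<^sub>N 1"
  using prec_mult_left[of "inverse n" 1 n] prec_N[of 1 n] nonzero_N[of n] by auto

text \<open>By invariance it is enough to apply \<open>prec_level\<close> to
  \<open>\<alpha> * p * inverse q\<close>.\<close>

lemma prec_level': "\<exists>\<alpha>. inverse \<alpha> \<prec>\<^sub>N 1 \<and> 1 \<prec>\<^sub>N \<alpha> \<and> (\<forall>p\<in>N. \<forall>q\<in>N. p \<prec>\<^sub>N q \<or> inverse \<alpha> * q \<prec>\<^sub>N p)"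
proof -
  obtain \<alpha> where \<alpha>: "1 \<prec>\<^sub>N \<alpha>" "\<And>p. p \<in> N \<Longrightarrow> p \<prec>\<^sub>N \<alpha> \<or> 1 \<prec>\<^sub>N p" using prec_level by blast
  have aN: "\<alpha> \<in> N" "\<alpha> \<noteq> 0" using prec_N[OF \<alpha>(1)] by auto
  have "p \<prec>\<^sub>N q \<or> inverse \<alpha> * q \<prec>\<^sub>N p" if pq: "p \<in> N" "q \<in> N" for p q
  proof -
    define s where "s = \<alpha> * p * inverse q"
    have s: "s \<in> N" "s * q = \<alpha> * p"
      using pq aN nonzero_N[of q] by (auto simp: s_def mult.assoc intro!: mult_N)
    from \<alpha>(2)[OF s(1)] show ?thesis
    proof
      assume "s \<prec>\<^sub>N \<alpha>"
      then have "\<alpha> * p \<prec>\<^sub>N \<alpha> * q" using prec_mult_right[OF pq(2), of s \<alpha>] s by simp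
      then show ?thesis using prec_mult_left_iff aN by blast
    next
      assume "1 \<prec>\<^sub>N s"
      then have "q \<prec>\<^sub>N \<alpha> * p" using prec_mult_right[OF pq(2), of 1 s] s by simp
      then have "inverse \<alpha> * q \<prec>\<^sub>N inverse \<alpha> * (\<alpha> * p)" using prec_mult_left aN by simp
      then show ?thesis using aN by (simp add: mult.assoc[symmetric])
    qed
  qed
  then show ?thesis using \<alpha> prec_inverse_1 by blast
qed

lemma ex_prec_lower2: "n \<in> N \<Longrightarrow> m \<in> N \<Longrightarrow> \<exists>k. k \<prec>\<^sub>N n \<and> k \<prec>\<^sub>N m"
proof -
  assume nm: "n \<in> N" "m \<in> N"
  obtain \<alpha> where \<alpha>: "inverse \<alpha> \<prec>\<^sub>N 1" "\<And>p q. p \<in> N \<Longrightarrow> q \<in> N \<Longrightarrow> p \<prec>\<^sub>N q \<or> inverse \<alpha> * q \<prec>\<^sub>N p"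
    using prec_level' by blast
  have l: "inverse \<alpha> * p \<prec>\<^sub>N p" if "p \<in> N" for p using prec_mult_right[OF that \<alpha>(1)] by simp
  from \<alpha>(2)[OF nm] show ?thesis
  proof
    assume "n \<prec>\<^sub>N m"
    then show ?thesis using l[OF nm(1)] prec_trans by blast
  qed (use l[OF nm(2)] in blast)
qed

lemma prec_inverse: "n \<prec>\<^sub>N m \<Longrightarrow> inverse m \<prec>\<^sub>N inverse n"
  using prec_mult_left[of "inverse m" n m] prec_mult_right[of "inverse n" "inverse m * n" 1]
    prec_N[of n m] nonzero_N[of n] nonzero_N[of m] by (auto simp: mult.assoc)

lemma ex_prec_lower: "finite A \<Longrightarrow> A \<subseteq> N \<Longrightarrow> \<exists>k\<in>N. \<forall>a\<in>A. k \<prec>\<^sub>N a"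
proof (induction A rule: finite_induct)
  case (insert a A)
  then obtain k where "k \<in> N" "\<forall>a\<in>A. k \<prec>\<^sub>N a" by auto
  moreover obtain k' where "k' \<prec>\<^sub>N k" "k' \<prec>\<^sub>N a" using ex_prec_lower2[of k a] insert calculation by auto
  ultimately show ?case using prec_trans prec_N by blast
qed (use one_N in blast)

lemma ex_prec_upper:
  assumes "finite A" "A \<subseteq> N" shows "\<exists>k\<in>N. \<forall>a\<in>A. a \<prec>\<^sub>N k"
proof -
  have "inverse ` A \<subseteq> N" using assms(2) by auto
  from ex_prec_lower[OF finite_imageI[OF assms(1)] this]
  obtain k where k: "k \<in> N" "\<forall>a\<in>inverse ` A. k \<prec>\<^sub>N a" by blast
  have "a \<prec>\<^sub>N inverse k" if "a \<in> A" for a using prec_inverse[of k "inverse a"] k(2) that by simp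
  then show ?thesis using k by (intro bexI[of _ "inverse k"]) auto
qed

lemma ex_small: "\<exists>n. small z n"
proof -
  obtain n m where nm: "n \<in> N" "m \<in> N" "z = n - m" using N_diff by blast
  obtain k where "n \<prec>\<^sub>N k" "m \<prec>\<^sub>N k" using ex_prec_upper[of "{n, m}"] nm by auto
  then show ?thesis using small_diff small_gen nm by blast
qed

text \<open>
  An element \<open>a\<close> of the coset \<open>x N\<close> that is not too small stays so when it is changed by small
  elements of \<open>N\<close>, without any loss; hence it may be changed by arbitrary sums of them.
\<close>

lemma one_minus_small: "\<exists>\<delta>\<in>N. \<forall>z. small z \<delta> \<longrightarrow> 1 - z \<in> N"
proof -
  obtain \<alpha> where \<alpha>: "inverse \<alpha> \<prec>\<^sub>N 1" "1 \<prec>\<^sub>N \<alpha>"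
      "\<And>p q. p \<in> N \<Longrightarrow> q \<in> N \<Longrightarrow> p \<prec>\<^sub>N q \<or> inverse \<alpha> * q \<prec>\<^sub>N p"
    using prec_level' by blast
  have aN: "\<alpha> \<in> N" "\<alpha> \<noteq> 0" using prec_N[OF \<alpha>(2)] by auto
  obtain \<kappa> where \<kappa>: "1 \<prec>\<^sub>N \<kappa>" using ex_prec by blast
  then have kN: "\<kappa> \<in> N" "\<kappa> \<noteq> 0" using prec_N[OF \<kappa>] by auto
  obtain a0 where a0: "a0 \<in> lcos x" "1 \<lless> a0" "a0 \<lless> \<kappa>" using \<kappa> by (rule precE)
  have a00: "a0 \<noteq> 0" using a0 lcos_nonzero by blast
  obtain m0 where m0: "m0 \<in> N" "m0 \<lless> a0" using ex_below a00 by blast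
  have a0m0: "\<not> a0 \<lless> m0" using below_asym m0 a0 by blast
  \<comment> \<open>The factor \<open>inverse \<kappa>\<close> pays for the gap in
    \<open>n \<lless> a \<lless> n * \<kappa>\<close>, and \<open>inverse \<alpha>\<close> for the
    defect of totality. Thus everything before \<open>\<epsilon>\<close> is below every
    \<open>a\<close> in \<open>x N\<close> that is not below \<open>m0\<close>.\<close>
  define \<epsilon> where "\<epsilon> = inverse \<alpha> * m0 * inverse \<kappa>"
  have \<epsilon>m0: "\<epsilon> \<prec>\<^sub>N m0"
  proof -
    have "m0 * inverse \<kappa> \<prec>\<^sub>N m0" using prec_mult_left[OF m0(1) prec_inverse_1[OF \<kappa>]] by simp
    moreover have "inverse \<alpha> * (m0 * inverse \<kappa>) \<prec>\<^sub>N 1 * (m0 * inverse \<kappa>)"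
      using prec_mult_right[OF _ \<alpha>(1)] m0 kN by (simp add: mult_N)
    ultimately show ?thesis using prec_trans by (simp add: \<epsilon>_def mult.assoc)
  qed
  have step: "a - r \<in> lcos x \<and> \<not> a - r \<lless> m0"
    if a: "a \<in> lcos x" "\<not> a \<lless> m0" and r: "r \<prec>\<^sub>N \<epsilon>" for a r
  proof -
    define n where "n = a * inverse a0"
    have n: "n \<in> N" "n * a0 = a"
    proof -
      have "inverse a0 * a \<in> N" using lcos_trans[OF lcos_sym[OF a0(1)] a(1)] by (simp add: lcos_def)
      then show "n \<in> N" by (simp add: n_def mult_N_commute)
    qed (use a00 in \<open>simp add: n_def mult.assoc\<close>)
    have na: "n \<lless> a" "a \<lless> n * \<kappa>"
      using a0 n nonzero_N[OF n(1)] below_mult_left[of n 1 a0] below_mult_left[of n a0 \<kappa>] by auto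
    have "\<not> n * \<kappa> \<prec>\<^sub>N m0" using below_prec[of a "n * \<kappa>" m0] na a by blast
    then have "inverse \<alpha> * m0 \<prec>\<^sub>N n * \<kappa>" using \<alpha>(3)[of "n * \<kappa>" m0] n kN m0 mult_N by blast
    then have "\<epsilon> \<prec>\<^sub>N n * \<kappa> * inverse \<kappa>" unfolding \<epsilon>_def using prec_mult_right kN by simp
    then have "\<epsilon> \<prec>\<^sub>N n" using kN by (simp add: mult.assoc)
    then have "r \<lless> a" using prec_below[of a] prec_trans[OF r] na a by blast
    then have ar: "a - r \<in> lcos x" using below_lcos a lcos_nonzero lcos_trans by blast
    obtain b where b: "b \<in> lcos y" "r \<lless> b" "b \<lless> m0" using prec_trans[OF r \<epsilon>m0] by (rule precE)
    have br: "b - r \<in> lcos y" using below_lcos b lcos_nonzero lcos_trans by blast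
    \<comment> \<open>The sum \<open>(a - r) + b\<close> equals \<open>a + (b - r)\<close>, and
      \<open>b\<close> and \<open>b - r\<close> both lie in \<open>y N\<close>. Applying
      \<open>far_below_sum\<close> to the two decompositions preserves the same
      \<open>m0\<close>.\<close>
    have "\<not> a - r \<lless> m0"
    proof
      assume "a - r \<lless> m0"
      then have "(a - r) + b \<lless> m0" using far_below_sum far_X_Y ar b m0 by blast
      moreover have "(a - r) + b = a + (b - r)" by simp
      ultimately have "a + (b - r) \<lless> m0" by metis
      then show False using far_below_sum[of a "b - r" m0] far_X_Y[OF a(1) br] m0 a by blast
    qed
    then show ?thesis using ar by blast
  qed
  \<comment> \<open>Generators enter \<open>W\<close> with both signs; this extra factor allows a
    change of sign, because \<open>- 1\<close> precedes \<open>\<alpha>\<close>.\<close>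
  define \<epsilon>' where "\<epsilon>' = inverse \<alpha> * \<epsilon>"
  have eN: "\<epsilon> \<in> N" using prec_N[OF \<epsilon>m0] by blast
  have neg: "- 1 \<prec>\<^sub>N \<alpha>"
  proof (rule ccontr)
    assume "\<not> - 1 \<prec>\<^sub>N \<alpha>"
    then have "1 \<prec>\<^sub>N - 1" using \<alpha>(3)[of "- 1" \<alpha>] aN by simp
    moreover from prec_mult_left[OF neg_one_N this] have "- 1 \<prec>\<^sub>N 1" by simp
    ultimately show False using prec_trans prec_irrefl by blast
  qed
  have small: "r \<prec>\<^sub>N \<epsilon> \<and> - r \<prec>\<^sub>N \<epsilon>" if r: "r \<prec>\<^sub>N \<epsilon>'" for r
  proof -
    have rN: "r \<in> N" using prec_N[OF r] by blast
    have "\<epsilon>' \<prec>\<^sub>N \<epsilon>" using prec_mult_right[OF eN \<alpha>(1)] by (simp add: \<epsilon>'_def)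
    moreover have "- r \<prec>\<^sub>N \<alpha> * r" using prec_mult_right[OF rN neg] by simp
    moreover have "\<alpha> * r \<prec>\<^sub>N \<epsilon>"
      using prec_mult_left[OF aN(1) r] aN by (simp add: \<epsilon>'_def mult.assoc[symmetric])
    ultimately show ?thesis using r prec_trans by blast
  qed
  have e'N: "\<epsilon>' \<in> N" using eN aN by (simp add: \<epsilon>'_def mult_N)
  have "a0 - w * \<epsilon>' \<in> lcos x \<and> \<not> a0 - w * \<epsilon>' \<lless> m0" if "w \<in> W" for w
    using that
  proof (induction rule: W.induct)
    case W_0
    then show ?case using a0 a0m0 by simp
  next
    case (W_add w r)
    have "r * \<epsilon>' \<prec>\<^sub>N \<epsilon>'" using prec_mult_right[OF e'N W_add(2)] by simp
    then show ?case using step[of "a0 - w * \<epsilon>'" "r * \<epsilon>'"] W_add small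
      by (simp add: algebra_simps)
  next
    case (W_sub w r)
    have "r * \<epsilon>' \<prec>\<^sub>N \<epsilon>'" using prec_mult_right[OF e'N W_sub(2)] by simp
    then show ?case using step[of "a0 - w * \<epsilon>'" "- (r * \<epsilon>')"] W_sub small
      by (simp add: algebra_simps)
  qed
  note W_step = this
  have *: "a0 - z \<in> lcos x" if "small z \<epsilon>'" for z
  proof -
    have "z * inverse \<epsilon>' * \<epsilon>' = z" using nonzero_N[OF e'N] by (simp add: mult.assoc)
    then show ?thesis using W_step[of "z * inverse \<epsilon>'"] that by (simp add: small_def)
  qed
  obtain n where n: "small a0 n" using ex_small by blast
  then have nN: "n \<in> N" by (simp add: small_def)
  show ?thesis
  proof (intro bexI[of _ "inverse n * \<epsilon>'"] allI impI)
    fix z assume "small z (inverse n * \<epsilon>')"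
    then have "small (a0 * z) (n * (inverse n * \<epsilon>'))" by (rule small_mult[OF n])
    then have "small (a0 * z) \<epsilon>'" using nonzero_N[OF nN] by (simp add: mult.assoc[symmetric])
    then have "a0 - a0 * z \<in> lcos a0" using * a0 lcos_sym lcos_trans by blast
    then show "1 - z \<in> N"
      using a00 by (simp add: lcos_def right_diff_distrib mult.assoc[symmetric])
  qed (use nN e'N in \<open>simp add: mult_N\<close>)
qed

text \<open>Write \<open>z = n * g\<close> with \<open>g\<close> in \<open>F\<close>. Then
  \<open>n\<close> or its inverse is bounded by \<open>prec_level\<close>, and only finitely many
  constants for the elements of \<open>F\<close> remain to be dominated.\<close>

lemma small_or_inverse_small: "\<exists>\<beta>\<in>N. \<forall>z. z \<noteq> 0 \<longrightarrow> small z \<beta> \<or> small (inverse z) \<beta>"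
proof -
  obtain \<alpha> where \<alpha>: "1 \<prec>\<^sub>N \<alpha>" "\<And>p. p \<in> N \<Longrightarrow> p \<prec>\<^sub>N \<alpha> \<or> 1 \<prec>\<^sub>N p" using prec_level by blast
  obtain \<nu> where \<nu>: "\<And>z. small z (\<nu> z)" using ex_small by metis
  then have \<nu>N: "\<nu> z \<in> N" for z by (simp add: small_def)
  define A where "A = (\<lambda>g. \<alpha> * \<nu> g) ` F \<union> (\<lambda>g. \<nu> (inverse g) * 1) ` F"
  have "finite A" "A \<subseteq> N" using finite_F \<nu>N prec_N[OF \<alpha>(1)] by (auto simp: A_def intro: mult_N)
  then obtain \<beta> where \<beta>: "\<beta> \<in> N" "\<forall>a\<in>A. a \<prec>\<^sub>N \<beta>" using ex_prec_upper by blast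
  have "small z \<beta> \<or> small (inverse z) \<beta>" if z: "z \<noteq> 0" for z
  proof -
    obtain g where g: "g \<in> F" "g \<noteq> 0" "inverse g * z \<in> N" using F_cover[OF z] by (auto simp: lcos_def)
    define n where "n = z * inverse g"
    have n: "n \<in> N" "z = n * g" using g by (auto simp: n_def mult_N_commute mult.assoc)
    from \<alpha>(2)[OF n(1)] show ?thesis
    proof
      assume "n \<prec>\<^sub>N \<alpha>"
      then have "small (n * g) (\<alpha> * \<nu> g)" using small_mult small_gen \<nu> by blast
      moreover have "\<alpha> * \<nu> g \<prec>\<^sub>N \<beta>" using \<beta> g by (auto simp: A_def)
      ultimately show ?thesis using small_mono n by metis
    next
      assume "1 \<prec>\<^sub>N n"
      then have "small (inverse g * inverse n) (\<nu> (inverse g) * 1)"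
        using small_mult \<nu> small_gen prec_inverse_1 by blast
      moreover have "inverse z = inverse g * inverse n"
        using n g nonzero_N by (simp add: nonzero_inverse_mult_distrib)
      moreover have "\<nu> (inverse g) * 1 \<prec>\<^sub>N \<beta>" using \<beta> g by (auto simp: A_def)
      ultimately show ?thesis using small_mono by metis
    qed
  qed
  then show ?thesis using \<beta> by blast
qed

end

subsection \<open>Elementary operators and the centre\<close>

definition central :: "'a::division_ring \<Rightarrow> bool" where
  "central z \<longleftrightarrow> (\<forall>w. z * w = w * z)"

lemma central_commute: "central z \<Longrightarrow> z * w = w * z"
  by (simp add: central_def)

lemma central_left_commute:
  assumes "central z" shows "w * (z * v) = z * (w * v)"
proof -
  have "w * z = z * w" using central_commute[OF assms, of w] by (rule sym)
  then show ?thesis by (simp only: mult.assoc[symmetric])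
qed

lemma central_mult:
  assumes "central z" "central w" shows "central (z * w)"
  unfolding central_def
proof
  fix v
  have "v * (z * w) = z * (v * w)" by (rule central_left_commute[OF assms(1)])
  also have "v * w = w * v" using central_commute[OF assms(2)] by simp
  finally show "z * w * v = v * (z * w)" by (simp add: mult.assoc)
qed

lemma central_closed [simp]:
  "central 0" "central 1"
  "central z \<Longrightarrow> central w \<Longrightarrow> central (z + w)"
  "central z \<Longrightarrow> central w \<Longrightarrow> central (z * w)"
  "central z \<Longrightarrow> central (- z)"
  by (rule central_mult | simp add: central_def algebra_simps)+

lemma central_inverse:
  assumes "central z" shows "central (inverse z)"
proof (cases "z = 0")
  case False
  have "inverse z * w = w * inverse z" for w
  proof -
    have "inverse z * w = inverse z * (w * z) * inverse z" using False by (simp add: mult.assoc)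
    also have "w * z = z * w" using central_commute[OF assms] by simp
    finally show ?thesis using False by (simp add: mult.assoc[symmetric])
  qed
  then show ?thesis by (simp add: central_def)
qed simp

lemma central_power: "central z \<Longrightarrow> central (z ^ n)"
  by (induction n) auto

lemma central_sum: "(\<And>i. i \<in> I \<Longrightarrow> central (f i)) \<Longrightarrow> central (sum f I)"
  by (induction I rule: infinite_finite_induct) auto

inductive elem_op :: "('a::division_ring \<Rightarrow> 'a) \<Rightarrow> bool" where
  elem_op_mult: "elem_op (\<lambda>z. a * z * b)"
| elem_op_add: "elem_op f \<Longrightarrow> elem_op g \<Longrightarrow> elem_op (\<lambda>z. f z + g z)"

lemma elem_op_id: "elem_op (\<lambda>z. z)"
  using elem_op_mult[of 1 1] by simp

lemma elem_op_mult_left: "elem_op f \<Longrightarrow> elem_op (\<lambda>z. c * f z)"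
proof (induction rule: elem_op.induct)
  case (elem_op_mult a b)
  then show ?case using elem_op.elem_op_mult[of "c * a" b] by (simp add: mult.assoc)
next
  case (elem_op_add f g)
  then show ?case using elem_op.elem_op_add[OF elem_op_add.IH] by (simp add: distrib_left)
qed

lemma elem_op_mult_right: "elem_op f \<Longrightarrow> elem_op (\<lambda>z. f z * c)"
proof (induction rule: elem_op.induct)
  case (elem_op_mult a b)
  then show ?case using elem_op.elem_op_mult[of a "b * c"] by (simp add: mult.assoc)
next
  case (elem_op_add f g)
  then show ?case using elem_op.elem_op_add[OF elem_op_add.IH] by (simp add: distrib_right)
qed

lemma elem_op_arg_mult: "elem_op f \<Longrightarrow> elem_op (\<lambda>z. f (z * c))"
proof (induction rule: elem_op.induct)
  case (elem_op_mult a b)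
  then show ?case using elem_op.elem_op_mult[of a "c * b"] by (simp add: mult.assoc)
next
  case (elem_op_add f g)
  then show ?case using elem_op.elem_op_add[OF elem_op_add.IH] by simp
qed

lemma elem_op_diff: "elem_op f \<Longrightarrow> elem_op g \<Longrightarrow> elem_op (\<lambda>z. f z - g z)"
  using elem_op_add[of f "\<lambda>z. - 1 * g z"] elem_op_mult_left[of g "- 1"] by simp

lemma elem_op_sum:
  "finite I \<Longrightarrow> (\<And>i. i \<in> I \<Longrightarrow> elem_op (f i)) \<Longrightarrow> elem_op (\<lambda>z. \<Sum>i\<in>I. f i z)"
proof (induction I rule: finite_induct)
  case empty
  then show ?case using elem_op_mult[of 0 0] by simp
qed (simp add: elem_op_add)

lemma elem_op_plus: "elem_op f \<Longrightarrow> f (z + w) = f z + f w"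
  by (induction rule: elem_op.induct) (simp_all add: algebra_simps)

lemma elem_op_central: "elem_op f \<Longrightarrow> central \<zeta> \<Longrightarrow> f (\<zeta> * z) = \<zeta> * f z"
  by (induction rule: elem_op.induct)
    (simp_all add: distrib_left mult.assoc, rule central_left_commute)

lemma elem_op_0: "elem_op f \<Longrightarrow> f 0 = 0"
  by (induction rule: elem_op.induct) simp_all

lemma elem_op_sum_arg: "elem_op f \<Longrightarrow> f (\<Sum>i\<in>I. g i) = (\<Sum>i\<in>I. f (g i))"
  by (induction I rule: infinite_finite_induct) (simp_all add: elem_op_0 elem_op_plus)

definition central_span :: "'a::division_ring set \<Rightarrow> 'a set" where
  "central_span B = {s. \<exists>\<zeta>. (\<forall>e\<in>B. central (\<zeta> e)) \<and> s = (\<Sum>e\<in>B. \<zeta> e * e)}"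

lemma central_spanI: "(\<And>e. e \<in> B \<Longrightarrow> central (\<zeta> e)) \<Longrightarrow> s = (\<Sum>e\<in>B. \<zeta> e * e) \<Longrightarrow> s \<in> central_span B"
  unfolding central_span_def by blast

lemma central_spanE:
  assumes "s \<in> central_span B"
  obtains \<zeta> where "\<And>e. e \<in> B \<Longrightarrow> central (\<zeta> e)" "s = (\<Sum>e\<in>B. \<zeta> e * e)"
  using assms unfolding central_span_def by blast

definition dual_family :: "'a::division_ring set \<Rightarrow> ('a \<Rightarrow> 'a \<Rightarrow> 'a) \<Rightarrow> bool" where
  "dual_family B f \<longleftrightarrow> finite B \<and> (\<forall>e\<in>B. elem_op (f e)) \<and>
     (\<forall>e\<in>B. \<forall>e'\<in>B. f e e' = (if e = e' then 1 else 0))"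

text \<open>
  If no elementary operator separates \<open>s\<close> from \<open>B\<close>, then the operators
  \<open>\<lambda>z. a * f e z - f e z * a\<close> vanish at \<open>s\<close>, so the coordinates \<open>f e s\<close> are central.
\<close>

lemma dual_elem_ops:
  assumes "finite S"
  shows "\<exists>B f. dual_family B f \<and> S \<subseteq> central_span B"
  using assms
proof (induction S rule: finite_induct)
  case empty
  then show ?case by (intro exI[of _ "{}"]) (auto simp: dual_family_def)
next
  case (insert s S)
  then obtain B f where Bf: "dual_family B f" "S \<subseteq> central_span B" by blast
  then have B: "finite B" "\<And>e. e \<in> B \<Longrightarrow> elem_op (f e)"
    "\<And>e e'. e \<in> B \<Longrightarrow> e' \<in> B \<Longrightarrow> f e e' = (if e = e' then 1 else 0)"
    by (auto simp: dual_family_def)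
  show ?case
  proof (cases "\<exists>T. elem_op T \<and> (\<forall>e\<in>B. T e = 0) \<and> T s \<noteq> 0")
    case True
    then obtain T where T: "elem_op T" "\<forall>e\<in>B. T e = 0" "T s \<noteq> 0" by blast
    then have sB: "s \<notin> B" by blast
    define h where "h z = inverse (T s) * T z" for z
    have h: "elem_op h" "h s = 1" "\<And>e. e \<in> B \<Longrightarrow> h e = 0"
      using T elem_op_mult_left[OF T(1)] by (auto simp: h_def[abs_def])
    \<comment> \<open>The old operators are corrected so that they vanish at the new basis element
      \<open>s\<close>; on \<open>B\<close> nothing changes because \<open>h\<close> vanishes
      there.\<close>
    define f' where "f' e = (if e = s then h else (\<lambda>z. f e z - f e s * h z))" for e
    show ?thesis
    proof (intro exI[of _ "insert s B"] exI[of _ f'] conjI subsetI)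
      have "elem_op (f' e)" if "e \<in> insert s B" for e
        using that h B(2) by (auto simp: f'_def intro!: elem_op_diff elem_op_mult_left)
      moreover have "f' e e' = (if e = e' then 1 else 0)" if "e \<in> insert s B" "e' \<in> insert s B" for e e'
        using that sB h B(3) by (auto simp: f'_def)
      ultimately show "dual_family (insert s B) f'" using B(1) by (simp add: dual_family_def)
      fix u assume u: "u \<in> insert s S"
      show "u \<in> central_span (insert s B)"
      proof (cases "u = s")
        case True
        have "(\<Sum>e\<in>B. (if e = s then 1 else 0) * e) = 0" using sB by (intro sum.neutral) auto
        then show ?thesis using True sB B(1)
          by (intro central_spanI[of _ "\<lambda>e. if e = s then 1 else 0"]) auto
      next
        case False
        then obtain \<zeta> where \<zeta>: "\<And>e. e \<in> B \<Longrightarrow> central (\<zeta> e)" "u = (\<Sum>e\<in>B. \<zeta> e * e)"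
          using Bf(2) u central_spanE by blast
        have "(\<Sum>e\<in>B. (\<zeta>(s := 0)) e * e) = (\<Sum>e\<in>B. \<zeta> e * e)"
          using sB by (intro sum.cong) auto
        then show ?thesis using \<zeta> sB B(1) by (intro central_spanI[of _ "\<zeta>(s := 0)"]) auto
      qed
    qed
  next
    case False
    then have kill: "T s = 0" if "elem_op T" "\<forall>e\<in>B. T e = 0" for T using that by blast
    have c: "central (f e s)" if "e \<in> B" for e
    proof -
      have "a * f e s - f e s * a = 0" for a
        by (rule kill[of "\<lambda>z. a * f e z - f e z * a"])
          (use that B(2,3) in \<open>auto intro!: elem_op_diff elem_op_mult_left elem_op_mult_right\<close>)
      then show ?thesis by (simp add: central_def)
    qed
    have "s - (\<Sum>e\<in>B. f e s * e) = 0"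
    proof (rule kill[of "\<lambda>z. z - (\<Sum>e\<in>B. f e z * e)"], goal_cases)
      case 1
      show "elem_op (\<lambda>z. z - (\<Sum>e\<in>B. f e z * e))"
        using B(1,2) by (intro elem_op_diff elem_op_id elem_op_sum elem_op_mult_right) auto
    next
      case 2
      show ?case
      proof
        fix e assume e: "e \<in> B"
        then have "(\<Sum>e'\<in>B. f e' e * e') = (\<Sum>e'\<in>B. if e' = e then e else 0)"
          using B(3) by (intro sum.cong) auto
        then show "e - (\<Sum>e'\<in>B. f e' e * e') = 0" using e B(1) by simp
      qed
    qed
    then have "s = (\<Sum>e\<in>B. f e s * e)" by simp
    then have "s \<in> central_span B" using c by (rule central_spanI[rotated])
    then show ?thesis using Bf by blast
  qed
qed

definition finite_over_centre :: "'a::division_ring itself \<Rightarrow> bool" where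
  "finite_over_centre _ \<longleftrightarrow> (\<exists>S :: 'a set. finite S \<and> central_span S = UNIV)"

lemma dual_family_coordinate:
  assumes "dual_family B f" "\<And>e. e \<in> B \<Longrightarrow> central (\<zeta> e)" "e \<in> B"
  shows "f e (\<Sum>e\<in>B. \<zeta> e * e) = \<zeta> e"
proof -
  have "f e (\<Sum>e\<in>B. \<zeta> e * e) = (\<Sum>e'\<in>B. \<zeta> e' * f e e')"
    using assms by (simp add: dual_family_def elem_op_sum_arg elem_op_central)
  also have "\<dots> = (\<Sum>e'\<in>B. if e' = e then \<zeta> e else 0)"
    using assms by (intro sum.cong) (auto simp: dual_family_def)
  finally show ?thesis using assms by (simp add: dual_family_def)
qed

text \<open>The span of \<open>B\<close> contains a spanning set and is closed under central
  combinations, so it is everything. Duality then forces the coefficient at \<open>e\<close> to be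
  \<open>f e z\<close>, which is how centrality of the coordinates arises.\<close>

lemma central_coordinates:
  assumes "finite_over_centre TYPE('a::division_ring)"
  shows "\<exists>(B :: 'a set) f. dual_family B f \<and>
     (\<forall>z. \<forall>e\<in>B. central (f e z)) \<and> (\<forall>z. z = (\<Sum>e\<in>B. f e z * e))"
proof -
  obtain S :: "'a set" where S: "finite S" "central_span S = UNIV"
    using assms unfolding finite_over_centre_def by blast
  obtain B and f :: "'a \<Rightarrow> 'a \<Rightarrow> 'a" where B: "dual_family B f" "S \<subseteq> central_span B"
    using dual_elem_ops[OF S(1)] by blast
  have "z \<in> central_span B" for z
  proof -
    have "z \<in> central_span S" using S(2) by simp
    then obtain \<eta> where \<eta>: "\<And>s. s \<in> S \<Longrightarrow> central (\<eta> s)" "z = (\<Sum>s\<in>S. \<eta> s * s)"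
      using central_spanE by blast
    have "\<forall>s\<in>S. \<exists>\<zeta>. (\<forall>e\<in>B. central (\<zeta> e)) \<and> s = (\<Sum>e\<in>B. \<zeta> e * e)"
      using B(2) by (auto simp: central_span_def)
    then obtain \<zeta> where \<zeta>: "\<And>s e. s \<in> S \<Longrightarrow> e \<in> B \<Longrightarrow> central (\<zeta> s e)"
      "\<And>s. s \<in> S \<Longrightarrow> (\<Sum>e\<in>B. \<zeta> s e * e) = s" by metis
    have "z = (\<Sum>s\<in>S. \<eta> s * (\<Sum>e\<in>B. \<zeta> s e * e))" unfolding \<eta>(2) using \<zeta>(2) by (intro sum.cong) auto
    also have "\<dots> = (\<Sum>e\<in>B. (\<Sum>s\<in>S. \<eta> s * \<zeta> s e) * e)"
      unfolding sum_distrib_left sum_distrib_right mult.assoc by (rule sum.swap)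
    finally show ?thesis using \<eta>(1) \<zeta>(1)
      by (intro central_spanI[of _ "\<lambda>e. \<Sum>s\<in>S. \<eta> s * \<zeta> s e"]) (auto intro!: central_sum)
  qed
  note span = this
  have "(\<forall>e\<in>B. central (f e z)) \<and> z = (\<Sum>e\<in>B. f e z * e)" for z
  proof -
    obtain \<zeta> where \<zeta>: "\<And>e. e \<in> B \<Longrightarrow> central (\<zeta> e)" "z = (\<Sum>e\<in>B. \<zeta> e * e)"
      using central_spanE[OF span] by blast
    then have "f e z = \<zeta> e" if "e \<in> B" for e using dual_family_coordinate[OF B(1), of \<zeta>] that by auto
    then show ?thesis using \<zeta> by simp
  qed
  then show ?thesis using B(1) by blast
qed

section \<open>Bounds for operators and small central elements\<close>

context far_coset_graph
begin

lemma elem_op_small: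
  assumes "elem_op f" shows "\<exists>n. \<forall>w\<in>W. small (f w) n"
  using assms
proof (induction rule: elem_op.induct)
  case (elem_op_mult a b)
  obtain n m where "small a n" "small b m" using ex_small by blast
  then show ?case using small_mult[OF small_mult] small_1 by blast
next
  case (elem_op_add f g)
  then obtain n m where nm: "\<forall>w\<in>W. small (f w) n" "\<forall>w\<in>W. small (g w) m" by blast
  then have "n \<in> N" "m \<in> N" using W_0 small_N by blast+
  then obtain k where "n \<prec>\<^sub>N k" "m \<prec>\<^sub>N k" using ex_prec_upper[of "{n, m}"] by auto
  then show ?case using nm small_add small_mono by blast
qed

text \<open>If everything were bounded by \<open>\<mu>\<close>, then
  \<open>1 = inverse r * r\<close> would be as small as desired by the choice of \<open>r\<close>,
  and \<open>1 - 1\<close> would lie in \<open>N\<close>.\<close>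

lemma all_not_small: "\<exists>z. \<not> small z \<mu>"
proof (rule ccontr)
  assume *: "\<not> ?thesis"
  then have \<mu>: "\<mu> \<in> N" by (auto simp: small_def)
  obtain \<delta> where \<delta>: "\<delta> \<in> N" "\<And>z. small z \<delta> \<Longrightarrow> 1 - z \<in> N" using one_minus_small by blast
  have N: "inverse \<mu> * \<delta> \<in> N" using \<mu> \<delta>(1) by (simp add: mult_N)
  obtain r where r: "r \<prec>\<^sub>N inverse \<mu> * \<delta>" using ex_prec_lower[of "{inverse \<mu> * \<delta>}"] N by auto
  have "small (inverse r * r) (\<mu> * (inverse \<mu> * \<delta>))"
    using * small_gen[OF r] by (intro small_mult) auto
  then have "small 1 \<delta>"
    using nonzero_N[OF \<mu>] prec_N[OF r] nonzero_N[of r] by (simp add: mult.assoc[symmetric])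
  then show False using \<delta>(2)[of 1] by simp
qed

text \<open>A bound for the centre would bound all central combinations of the finite spanning set,
  that is, everything. So there are large central elements, and the inverse of one of them is
  small.\<close>

lemma ex_central_small:
  assumes fin: "finite_over_centre TYPE('a)" and n: "n \<in> N"
  shows "\<exists>c. central c \<and> c \<noteq> 0 \<and> small c n"
proof -
  obtain S :: "'a set" where S: "finite S" "central_span S = UNIV"
    using fin unfolding finite_over_centre_def by blast
  have unb: "\<exists>\<zeta>. central \<zeta> \<and> \<not> small \<zeta> m" for m
  proof (rule ccontr)
    assume "\<not> ?thesis"
    then have all: "\<And>\<zeta>. central \<zeta> \<Longrightarrow> small \<zeta> m" by blast
    then have mN: "m \<in> N" using central_closed(1) small_N by blast
    obtain \<nu> where \<nu>: "\<And>z. small z (\<nu> z)" using ex_small by metis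
    have "(\<lambda>s. m * \<nu> s) ` S \<subseteq> N" using \<nu> mN by (auto simp: small_def intro: mult_N)
    then obtain k where k: "k \<in> N" "\<And>s. s \<in> S \<Longrightarrow> m * \<nu> s \<prec>\<^sub>N k"
      using ex_prec_upper[of "(\<lambda>s. m * \<nu> s) ` S"] S(1) by auto
    have "small z k" for z
    proof -
      obtain \<zeta> where \<zeta>: "\<And>s. s \<in> S \<Longrightarrow> central (\<zeta> s)" "z = (\<Sum>s\<in>S. \<zeta> s * s)"
        using central_spanE[of z S] S(2) by blast
      have "small (\<Sum>s\<in>T. \<zeta> s * s) k" if "T \<subseteq> S" for T
        using that
      proof (induction T rule: infinite_finite_induct)
        case (insert s T)
        then have "small (\<zeta> s * s) k" using small_mono[OF small_mult[OF all \<nu>] k(2)] \<zeta> by auto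
        then show ?case using insert small_add by auto
      qed (use small_0 k in auto)
      then show ?thesis using \<zeta> by blast
    qed
    then show False using all_not_small by blast
  qed
  obtain \<beta> where \<beta>: "\<beta> \<in> N" "\<And>z. z \<noteq> 0 \<Longrightarrow> small z \<beta> \<or> small (inverse z) \<beta>"
    using small_or_inverse_small by blast
  \<comment> \<open>Chosen so that \<open>inverse \<beta> * m = inverse n\<close>, which is the
    bound left after conjugating by \<open>m\<close>.\<close>
  define m where "m = \<beta> * inverse n"
  have m: "m \<in> N" using \<beta> n by (simp add: m_def mult_N)
  have bm: "\<beta> * m \<in> N" using \<beta> m mult_N by blast
  obtain \<zeta> where \<zeta>: "central \<zeta>" "\<not> small \<zeta> (\<beta> * m)" using unb by blast
  have nz: "\<zeta> \<noteq> 0" "m \<noteq> 0" "\<beta> \<noteq> 0" "n \<noteq> 0" using \<zeta> small_0 bm m \<beta> n nonzero_N by auto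
  have "\<not> small (\<zeta> * inverse m) \<beta>"
    using \<zeta>(2) bm nz by (auto simp: small_def nonzero_inverse_mult_distrib mult.assoc)
  then have "small (inverse (\<zeta> * inverse m)) \<beta>" using \<beta>(2)[of "\<zeta> * inverse m"] nz by simp
  then have "m * inverse \<zeta> * inverse \<beta> \<in> W" using nz by (simp add: small_def nonzero_inverse_mult_distrib)
  from W_conj[OF inverse_N[OF m] this]
  have "inverse \<zeta> * inverse \<beta> * m \<in> W" using nz by (simp add: mult.assoc[symmetric])
  then have "inverse \<zeta> * inverse n \<in> W"
    using nz by (simp add: m_def mult.assoc) (simp add: mult.assoc[symmetric])
  then show ?thesis using \<zeta> nz n by (intro exI[of _ "inverse \<zeta>"]) (simp add: central_inverse small_def)
qed

text \<open>One \<open>c\<close> absorbs all constants obtained so far: it only has to be small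
  relative to a common lower bound \<open>n\<close>. From here on, a loss is measured by the number
  of factors \<open>c\<close>.\<close>

lemma ex_central_scaling:
  assumes fin: "finite_over_centre TYPE('a)"
    and J: "finite J" "\<And>j. j \<in> J \<Longrightarrow> elem_op (f j)"
  shows "\<exists>c. central c \<and> c \<noteq> 0 \<and> c \<in> W \<and> (\<forall>w\<in>W. 1 + c * w \<in> N) \<and>
     (\<forall>z. z \<noteq> 0 \<longrightarrow> c * z \<in> W \<or> c * inverse z \<in> W) \<and> (\<forall>j\<in>J. \<forall>w\<in>W. c * f j w \<in> W)"
proof -
  obtain \<mu> where \<mu>: "\<And>j w. j \<in> J \<Longrightarrow> w \<in> W \<Longrightarrow> small (f j w) (\<mu> j)"
    using elem_op_small[OF J(2)] by metis
  then have \<mu>N: "\<And>j. j \<in> J \<Longrightarrow> \<mu> j \<in> N" using W_0 small_N by blast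
  obtain \<beta> where \<beta>: "\<beta> \<in> N" "\<And>z. z \<noteq> 0 \<Longrightarrow> small z \<beta> \<or> small (inverse z) \<beta>"
    using small_or_inverse_small by blast
  obtain \<delta> where \<delta>: "\<delta> \<in> N" "\<And>z. small z \<delta> \<Longrightarrow> 1 - z \<in> N" using one_minus_small by blast
  obtain n where n: "n \<in> N" "n \<prec>\<^sub>N 1" "n \<prec>\<^sub>N \<delta>" "n \<prec>\<^sub>N inverse \<beta>" "\<And>j. j \<in> J \<Longrightarrow> n \<prec>\<^sub>N inverse (\<mu> j)"
  proof -
    have "(\<lambda>j. inverse (\<mu> j)) ` J \<subseteq> N" using \<mu>N by auto
    then show ?thesis
      using ex_prec_lower[of "{1, \<delta>, inverse \<beta>} \<union> (\<lambda>j. inverse (\<mu> j)) ` J"] J(1) \<beta>(1) \<delta>(1) that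
      by auto
  qed
  obtain c where c: "central c" "c \<noteq> 0" "small c n" using ex_central_small[OF fin n(1)] by blast
  have scale: "c * z \<in> W" if "small z m" "n \<prec>\<^sub>N inverse m" for z m
  proof -
    have mN: "m \<in> N" using that by (simp add: small_def)
    then have "n * m \<prec>\<^sub>N 1" using prec_mult_right[OF mN that(2)] nonzero_N[OF mN] by simp
    then show ?thesis using small_mono[OF small_mult[OF c(3) that(1)]] small_1 by blast
  qed
  have "1 + c * w \<in> N" if "w \<in> W" for w
  proof -
    have "small (c * w) (n * 1)" using c that small_1 small_mult by blast
    then have "small (- (c * w)) \<delta>" using small_mono n(3) small_uminus by fastforce
    then show ?thesis using \<delta>(2) by fastforce
  qed
  moreover have "c \<in> W" using small_mono[OF c(3) n(2)] small_1 by blast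
  moreover have "c * z \<in> W \<or> c * inverse z \<in> W" if "z \<noteq> 0" for z
    using \<beta>(2)[OF that] scale n(4) by blast
  moreover have "c * f j w \<in> W" if "j \<in> J" "w \<in> W" for j w
    using scale[OF \<mu>[OF that] n(5)[OF that(1)]] .
  ultimately show ?thesis using c by blast
qed

end

subsection \<open>The norm over the centre\<close>

text \<open>The determinant takes its entries from a commutative ring given as a type, so the centre
  is turned into one.\<close>

typedef (overloaded) 'a centre = "{z :: 'a::division_ring. central z}"
  morphisms of_centre to_centre by (auto intro: exI[of _ 0])

setup_lifting type_definition_centre

instantiation centre :: (division_ring) comm_ring_1
begin

lift_definition zero_centre :: "'a centre" is 0 by simp
lift_definition one_centre :: "'a centre" is 1 by simp
lift_definition plus_centre :: "'a centre \<Rightarrow> 'a centre \<Rightarrow> 'a centre" is "(+)" by simp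
lift_definition minus_centre :: "'a centre \<Rightarrow> 'a centre \<Rightarrow> 'a centre" is "(-)"
  using central_closed(3)[OF _ central_closed(5)] by fastforce
lift_definition uminus_centre :: "'a centre \<Rightarrow> 'a centre" is uminus by simp
lift_definition times_centre :: "'a centre \<Rightarrow> 'a centre \<Rightarrow> 'a centre" is "(*)" by simp

instance
  by standard (transfer; simp add: algebra_simps central_commute)+

end

lemma of_centre_sum: "of_centre (sum f I) = (\<Sum>i\<in>I. of_centre (f i))"
  by (induction I rule: infinite_finite_induct)
    (simp_all add: zero_centre.rep_eq plus_centre.rep_eq)

lemma of_centre_power: "of_centre (z ^ n) = of_centre z ^ n"
  by (induction n) (simp_all add: one_centre.rep_eq times_centre.rep_eq)

lemma central_of_centre: "central (of_centre z)"
  using of_centre by blast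

lemma of_centre_to_centre: "central z \<Longrightarrow> of_centre (to_centre z) = z"
  by (simp add: to_centre_inverse)

text \<open>Leibniz expansion of the determinant of \<open>t\<close> times the matrix: every summand
  is, up to sign, a product of elements of \<open>W\<close>.\<close>

lemma of_centre_det_bound:
  fixes W :: "'a::division_ring set" and A :: "'a centre mat"
  assumes W: "0 \<in> W" "\<And>z w. z \<in> W \<Longrightarrow> w \<in> W \<Longrightarrow> z + w \<in> W" "\<And>z. z \<in> W \<Longrightarrow> - z \<in> W"
      "\<And>z w. z \<in> W \<Longrightarrow> w \<in> W \<Longrightarrow> z * w \<in> W"
    and A: "A \<in> carrier_mat n n" "n > 0"
    and t: "\<And>i j. i < n \<Longrightarrow> j < n \<Longrightarrow> of_centre t * of_centre (A $$ (i, j)) \<in> W"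
  shows "of_centre t ^ n * of_centre (det A) \<in> W"
proof -
  have sum_W: "of_centre (sum f I) \<in> W" if "\<And>i. i \<in> I \<Longrightarrow> of_centre (f i) \<in> W" for f :: "'b \<Rightarrow> 'a centre" and I
    using that by (induction I rule: infinite_finite_induct)
      (auto simp: zero_centre.rep_eq plus_centre.rep_eq W)
  \<comment> \<open>The empty product is 1, which is not assumed to lie in \<open>W\<close>.\<close>
  have prod_W: "of_centre (prod f I) \<in> W" if "finite I" "I \<noteq> {}" "\<And>i. i \<in> I \<Longrightarrow> of_centre (f i) \<in> W"
    for f :: "nat \<Rightarrow> 'a centre" and I
    using that by (induction I rule: finite_ne_induct) (auto simp: times_centre.rep_eq W)
  have "t ^ n * det A = det (t \<cdot>\<^sub>m A)" using A by simp
  also have "\<dots> = (\<Sum>p\<in>{p. p permutes {0..<n}}. signof p * (\<Prod>i = 0..<n. (t \<cdot>\<^sub>m A) $$ (i, p i)))"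
    by (rule det_def') (use A in simp)
  finally have eq: "t ^ n * det A =
    (\<Sum>p\<in>{p. p permutes {0..<n}}. signof p * (\<Prod>i = 0..<n. (t \<cdot>\<^sub>m A) $$ (i, p i)))" .
  have "of_centre (t ^ n * det A) \<in> W"
    unfolding eq
  proof (rule sum_W)
    fix p assume p: "p \<in> {p. p permutes {0..<n}}"
    have "of_centre (\<Prod>i = 0..<n. (t \<cdot>\<^sub>m A) $$ (i, p i)) \<in> W"
    proof (rule prod_W)
      fix i assume i: "i \<in> {0..<n}"
      then have "p i < n" using p permutes_in_image[of p "{0..<n}" i] by simp
      then show "of_centre ((t \<cdot>\<^sub>m A) $$ (i, p i)) \<in> W" using i A t by (simp add: times_centre.rep_eq)
    qed (use A in auto)
    then show "of_centre (signof p * (\<Prod>i = 0..<n. (t \<cdot>\<^sub>m A) $$ (i, p i))) \<in> W"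
      using W(3) by (auto simp: sign_def uminus_centre.rep_eq)
  qed
  then show ?thesis by (simp add: times_centre.rep_eq of_centre_power)
qed

text \<open>The norm is the determinant of left multiplication over the centre.\<close>

lemma norm_over_centre:
  assumes "finite_over_centre TYPE('a::division_ring)"
  obtains J :: "('a::division_ring \<Rightarrow> 'a) set" and nrm :: "'a::division_ring \<Rightarrow> 'a" and d :: nat
  where "finite J" "\<And>f. f \<in> J \<Longrightarrow> elem_op f" "d > 0"
    "\<And>z. central (nrm z)" "nrm 1 = 1" "\<And>z w. nrm (z * w) = nrm z * nrm w"
    "\<And>c. central c \<Longrightarrow> nrm c = c ^ d"
    "\<And>W t z. 0 \<in> W \<Longrightarrow> (\<And>z w. z \<in> W \<Longrightarrow> w \<in> W \<Longrightarrow> z + w \<in> W) \<Longrightarrow> (\<And>z. z \<in> W \<Longrightarrow> - z \<in> W) \<Longrightarrow>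
       (\<And>z w. z \<in> W \<Longrightarrow> w \<in> W \<Longrightarrow> z * w \<in> W) \<Longrightarrow> central t \<Longrightarrow>
       (\<And>f. f \<in> J \<Longrightarrow> t * f z \<in> W) \<Longrightarrow> t ^ d * nrm z \<in> W"
proof -
  obtain B :: "'a set" and f where B: "dual_family B f"
    and cf: "\<And>z e. e \<in> B \<Longrightarrow> central (f e z)" and f: "\<And>z. z = (\<Sum>e\<in>B. f e z * e)"
    using central_coordinates[OF assms] by metis
  have finB: "finite B" and opf: "\<And>e. e \<in> B \<Longrightarrow> elem_op (f e)"
    and dual: "\<And>e e'. e \<in> B \<Longrightarrow> e' \<in> B \<Longrightarrow> f e e' = (if e = e' then 1 else 0)"
    using B by (auto simp: dual_family_def)
  define d where "d = card B"
  obtain b where b: "bij_betw b {0..<d} B" using ex_bij_betw_nat_finite[OF finB] d_def by blast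
  have bB: "b i \<in> B" if "i < d" for i using b that by (auto simp: bij_betw_def)
  have b_inj: "b i = b j \<longleftrightarrow> i = j" if "i < d" "j < d" for i j
    using b that by (auto simp: bij_betw_def inj_on_def)
  have d0: "d > 0"
  proof (rule ccontr)
    assume "\<not> d > 0"
    then have "B = {}" using finB by (simp add: d_def)
    then show False using f[of 1] by simp
  qed
  have fb: "z = (\<Sum>k = 0..<d. f (b k) z * b k)" for z
    using f[of z] sum.reindex_bij_betw[OF b, of "\<lambda>e. f e z * e"] by simp
  define M where "M z = mat d d (\<lambda>(i, j). to_centre (f (b i) (z * b j)))" for z
  have M_carrier: "M z \<in> carrier_mat d d" for z by (simp add: M_def)
  have M_entry: "of_centre (M z $$ (i, j)) = f (b i) (z * b j)" if "i < d" "j < d" for z i j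
    using that cf bB by (simp add: M_def of_centre_to_centre)
  have M_mult: "M (z * w) = M z * M w" for z w
  proof (rule eq_matI)
    fix i j assume "i < dim_row (M z * M w)" "j < dim_col (M z * M w)"
    then have ij: "i < d" "j < d" by (simp_all add: M_def)
    have "f (b i) (z * w * b j) = f (b i) (\<Sum>k = 0..<d. f (b k) (w * b j) * (z * b k))"
    proof -
      have "z * w * b j = z * (\<Sum>k = 0..<d. f (b k) (w * b j) * b k)"
        using fb[of "w * b j"] by (simp add: mult.assoc)
      also have "\<dots> = (\<Sum>k = 0..<d. f (b k) (w * b j) * (z * b k))"
        unfolding sum_distrib_left by (intro sum.cong refl central_left_commute cf bB) simp
      finally show ?thesis by simp
    qed
    also have "\<dots> = (\<Sum>k = 0..<d. f (b k) (w * b j) * f (b i) (z * b k))"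
      using opf[OF bB[OF ij(1)]]
      by (subst elem_op_sum_arg) (auto intro!: sum.cong elem_op_central cf bB)
    also have "\<dots> = (\<Sum>k = 0..<d. of_centre (M z $$ (i, k)) * of_centre (M w $$ (k, j)))"
      using ij by (intro sum.cong) (auto simp: M_entry intro!: central_commute cf bB)
    finally have "of_centre (M (z * w) $$ (i, j)) = of_centre ((M z * M w) $$ (i, j))"
      using ij M_carrier[of z] M_carrier[of w]
      by (simp add: M_entry scalar_prod_def of_centre_sum times_centre.rep_eq)
    then show "M (z * w) $$ (i, j) = (M z * M w) $$ (i, j)" by (simp add: of_centre_inject)
  qed (simp_all add: M_def)
  have M_central: "M c = to_centre c \<cdot>\<^sub>m 1\<^sub>m d" if c: "central c" for c
  proof (rule eq_matI)
    fix i j assume "i < dim_row (to_centre c \<cdot>\<^sub>m 1\<^sub>m d)" "j < dim_col (to_centre c \<cdot>\<^sub>m 1\<^sub>m d)"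
    then have ij: "i < d" "j < d" by simp_all
    have "f (b i) (c * b j) = (if i = j then c else 0)"
      using elem_op_central[OF opf c] dual bB ij b_inj by simp
    then have "of_centre (M c $$ (i, j)) = of_centre ((to_centre c \<cdot>\<^sub>m 1\<^sub>m d) $$ (i, j))"
      using ij c by (simp add: M_entry times_centre.rep_eq of_centre_to_centre zero_centre.rep_eq one_centre.rep_eq)
    then show "M c $$ (i, j) = (to_centre c \<cdot>\<^sub>m 1\<^sub>m d) $$ (i, j)" by (simp add: of_centre_inject)
  qed (simp_all add: M_def)
  define nrm where "nrm z = of_centre (det (M z))" for z
  \<comment> \<open>The matrix entries as functions of \<open>z\<close>. They are finitely many
    elementary operators, so a single scalar can bound all of them.\<close>
  define J where "J = (\<lambda>(i, j) z. f (b i) (z * b j)) ` ({0..<d} \<times> {0..<d})"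
  have nrm_central: "nrm c = c ^ d" if "central c" for c
    using that by (simp add: nrm_def M_central of_centre_power of_centre_to_centre)
  have nrm_mult: "nrm (z * w) = nrm z * nrm w" for z w
    by (simp add: nrm_def M_mult det_mult[OF M_carrier M_carrier] times_centre.rep_eq)
  have bound: "t ^ d * nrm z \<in> W"
    if W: "0 \<in> W" "\<And>z w. z \<in> W \<Longrightarrow> w \<in> W \<Longrightarrow> z + w \<in> W" "\<And>z. z \<in> W \<Longrightarrow> - z \<in> W"
        "\<And>z w. z \<in> W \<Longrightarrow> w \<in> W \<Longrightarrow> z * w \<in> W"
      and t: "central t" "\<And>f. f \<in> J \<Longrightarrow> t * f z \<in> W" for W t z
  proof -
    have "of_centre (to_centre t) ^ d * of_centre (det (M z)) \<in> W"
    proof (rule of_centre_det_bound[OF W M_carrier d0])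
      fix i j assume ij: "i < d" "j < d"
      then have "(\<lambda>z. f (b i) (z * b j)) \<in> J" by (force simp: J_def)
      from t(2)[OF this]
      show "of_centre (to_centre t) * of_centre (M z $$ (i, j)) \<in> W"
        using ij t(1) by (simp add: M_entry of_centre_to_centre)
    qed
    then show ?thesis using t by (simp add: nrm_def of_centre_to_centre)
  qed
  have "elem_op f" if "f \<in> J" for f
    using opf bB that by (auto simp: J_def intro: elem_op_arg_mult)
  moreover have "finite J" by (simp add: J_def)
  moreover have "central (nrm z)" for z by (simp add: nrm_def central_of_centre)
  ultimately show ?thesis
    using that[of J d nrm] d0 nrm_central nrm_central[of 1] nrm_mult bound by simp
qed

subsection \<open>Valuations from invariant valuation rings\<close>

lemma mult_inverse_cancel:
  fixes z w :: "'a::division_ring"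
  assumes "z \<noteq> 0" shows "z * (inverse z * w) = w" "inverse z * (z * w) = w"
  using assms by (simp_all add: mult.assoc[symmetric])

locale invariant_valuation_ring =
  fixes R :: "'a::division_ring set"
  assumes one_R: "1 \<in> R"
    and add_R: "z \<in> R \<Longrightarrow> w \<in> R \<Longrightarrow> z + w \<in> R"
    and mult_R: "z \<in> R \<Longrightarrow> w \<in> R \<Longrightarrow> z * w \<in> R"
    and conj_R: "g \<noteq> 0 \<Longrightarrow> z \<in> R \<Longrightarrow> g * z * inverse g \<in> R"
    and total_R: "z \<noteq> 0 \<Longrightarrow> z \<in> R \<or> inverse z \<in> R"
begin

definition U :: "'a set" where
  "U = {u. u \<noteq> 0 \<and> u \<in> R \<and> inverse u \<in> R}"

text \<open>The value of \<open>z\<close> is the coset \<open>z U\<close> itself, so that the value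
  group lives in the type \<open>'a set\<close>; at 0 the set is empty.\<close>

definition val :: "'a \<Rightarrow> 'a set" where
  "val z = {w. z \<noteq> 0 \<and> inverse z * w \<in> U}"

text \<open>The quotient by the unit group of \<open>R\<close>, ordered by divisibility in
  \<open>R\<close>. Invariance under conjugation makes the product of cosets a coset and the order
  two-sided.\<close>

definition \<Gamma> :: "'a set ordered_group" where
  "\<Gamma> = \<lparr>carrier = val ` (UNIV - {0}), monoid.mult = (\<lambda>A B. {a * b |a b. a \<in> A \<and> b \<in> B}),
     one = val 1, le_rel = {(val z, val w) |z w. z \<noteq> 0 \<and> w \<noteq> 0 \<and> inverse z * w \<in> R}\<rparr>"

lemma U_one: "1 \<in> U"
  by (simp add: U_def one_R)

lemma U_mult: "u \<in> U \<Longrightarrow> v \<in> U \<Longrightarrow> u * v \<in> U"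
  by (simp add: U_def mult_R nonzero_inverse_mult_distrib)

lemma U_inverse: "u \<in> U \<Longrightarrow> inverse u \<in> U"
  by (simp add: U_def)

lemma conj_R': "g \<noteq> 0 \<Longrightarrow> z \<in> R \<Longrightarrow> inverse g * z * g \<in> R"
  using conj_R[of "inverse g" z] by simp

lemma U_conj: "g \<noteq> 0 \<Longrightarrow> u \<in> U \<Longrightarrow> inverse g * u * g \<in> U"
  using conj_R'[of g u] conj_R'[of g "inverse u"]
  by (simp add: U_def nonzero_inverse_mult_distrib mult.assoc)

lemma val_eq_iff: "z \<noteq> 0 \<Longrightarrow> w \<noteq> 0 \<Longrightarrow> val z = val w \<longleftrightarrow> inverse z * w \<in> U"
proof
  assume *: "z \<noteq> 0" "w \<noteq> 0" "val z = val w"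
  have "w \<in> val w" using *(2) U_one by (simp add: val_def)
  then have "w \<in> val z" using *(3) by blast
  then show "inverse z * w \<in> U" by (simp add: val_def)
next
  assume *: "z \<noteq> 0" "w \<noteq> 0" "inverse z * w \<in> U"
  have e1: "(inverse z * w) * (inverse w * v) = inverse z * v" for v
    using *(2) by (simp add: mult.assoc mult_inverse_cancel)
  have e2: "inverse (inverse z * w) * (inverse z * v) = inverse w * v" for v
    using *(1,2) by (simp add: nonzero_inverse_mult_distrib mult.assoc mult_inverse_cancel)
  have "inverse z * v \<in> U \<longleftrightarrow> inverse w * v \<in> U" for v
    using U_mult[OF *(3), of "inverse w * v"] U_mult[OF U_inverse[OF *(3)], of "inverse z * v"]
    unfolding e1 e2 by blast
  then show "val z = val w" using * by (simp add: val_def)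
qed

lemma le_iff: 
  assumes "z \<noteq> 0" "w \<noteq> 0" shows "(val z, val w) \<in> le_rel \<Gamma> \<longleftrightarrow> inverse z * w \<in> R"
proof
  assume "(val z, val w) \<in> le_rel \<Gamma>"
  then obtain z' w' where *: "val z = val z'" "val w = val w'" "z' \<noteq> 0" "w' \<noteq> 0" "inverse z' * w' \<in> R"
    by (auto simp: \<Gamma>_def)
  then have "inverse z * z' \<in> R" "inverse w' * w \<in> R"
    using val_eq_iff[of z z'] val_eq_iff[of w' w] assms by (auto simp: U_def)
  then have "(inverse z * z') * (inverse z' * w') * (inverse w' * w) \<in> R" using *(5) mult_R by blast
  moreover have "(inverse z * z') * (inverse z' * w') * (inverse w' * w) = inverse z * w"
  proof -
    have "(inverse z * z') * (inverse z' * w') * (inverse w' * w)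
        = inverse z * ((z' * inverse z') * (w' * inverse w')) * w" by (simp only: mult.assoc)
    then show ?thesis using * by simp
  qed
  ultimately show "inverse z * w \<in> R" by simp
qed (use assms in \<open>auto simp: \<Gamma>_def\<close>)

lemma val_times:
  assumes "z \<noteq> 0" "w \<noteq> 0" shows "val z \<otimes>\<^bsub>\<Gamma>\<^esub> val w = val (z * w)"
proof -
  have "{a * b |a b. a \<in> val z \<and> b \<in> val w} = val (z * w)"
  proof (intro equalityI subsetI)
    fix c assume "c \<in> {a * b |a b. a \<in> val z \<and> b \<in> val w}"
    then obtain a b where *: "c = a * b" "inverse z * a \<in> U" "inverse w * b \<in> U"
      by (auto simp: val_def)
    have "(inverse w * (inverse z * a) * w) * (inverse w * b) \<in> U"
      using * assms U_conj U_mult by blast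
    moreover have "(inverse w * (inverse z * a) * w) * (inverse w * b) = inverse (z * w) * c"
    proof -
      have "(inverse w * (inverse z * a) * w) * (inverse w * b)
        = inverse w * (inverse z * a) * (w * inverse w) * b" by (simp only: mult.assoc)
      then show ?thesis using assms *(1) by (simp add: nonzero_inverse_mult_distrib mult.assoc)
    qed
    ultimately show "c \<in> val (z * w)" using assms by (simp add: val_def)
  next
    fix c assume c: "c \<in> val (z * w)"
    then have "inverse w * (inverse z * c) \<in> U"
      using assms by (simp add: val_def nonzero_inverse_mult_distrib mult.assoc)
    then have "z \<in> val z \<and> inverse z * c \<in> val w \<and> c = z * (inverse z * c)"
      using assms U_one by (simp add: val_def mult.assoc[symmetric])
    then show "c \<in> {a * b |a b. a \<in> val z \<and> b \<in> val w}" by blast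
  qed
  then show ?thesis by (simp add: \<Gamma>_def)
qed

lemma carrierE:
  assumes "A \<in> carrier \<Gamma>" obtains z where "z \<noteq> 0" "A = val z"
  using assms by (auto simp: \<Gamma>_def)

lemma val_carrier: "z \<noteq> 0 \<Longrightarrow> val z \<in> carrier \<Gamma>"
  by (simp add: \<Gamma>_def)

lemma one_\<Gamma>: "\<one>\<^bsub>\<Gamma>\<^esub> = val 1"
  by (simp add: \<Gamma>_def)

lemma group_\<Gamma>: "group \<Gamma>"
proof (rule groupI)
  fix A B assume "A \<in> carrier \<Gamma>" "B \<in> carrier \<Gamma>"
  then show "A \<otimes>\<^bsub>\<Gamma>\<^esub> B \<in> carrier \<Gamma>" by (auto elim!: carrierE simp: val_times val_carrier)
next
  fix A B C assume "A \<in> carrier \<Gamma>" "B \<in> carrier \<Gamma>" "C \<in> carrier \<Gamma>"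
  then show "A \<otimes>\<^bsub>\<Gamma>\<^esub> B \<otimes>\<^bsub>\<Gamma>\<^esub> C = A \<otimes>\<^bsub>\<Gamma>\<^esub> (B \<otimes>\<^bsub>\<Gamma>\<^esub> C)"
    by (auto elim!: carrierE simp: val_times mult.assoc)
next
  fix A assume "A \<in> carrier \<Gamma>"
  then obtain z where z: "z \<noteq> 0" "A = val z" by (rule carrierE)
  then show "\<one>\<^bsub>\<Gamma>\<^esub> \<otimes>\<^bsub>\<Gamma>\<^esub> A = A" by (simp add: one_\<Gamma> val_times)
  show "\<exists>B\<in>carrier \<Gamma>. B \<otimes>\<^bsub>\<Gamma>\<^esub> A = \<one>\<^bsub>\<Gamma>\<^esub>"
    using z by (intro bexI[of _ "val (inverse z)"]) (simp_all add: one_\<Gamma> val_times val_carrier)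
qed (simp add: one_\<Gamma> val_carrier)

lemma linear_\<Gamma>: "linear_order_on (carrier \<Gamma>) (le_rel \<Gamma>)"
proof -
  have sub: "le_rel \<Gamma> \<subseteq> carrier \<Gamma> \<times> carrier \<Gamma>" by (auto simp: \<Gamma>_def)
  have "refl_on (carrier \<Gamma>) (le_rel \<Gamma>)"
    using sub by (auto simp: refl_on_def le_iff one_R elim!: carrierE)
  moreover have "trans (le_rel \<Gamma>)"
  proof (rule transI)
    fix A B C assume *: "(A, B) \<in> le_rel \<Gamma>" "(B, C) \<in> le_rel \<Gamma>"
    then have "A \<in> carrier \<Gamma>" "B \<in> carrier \<Gamma>" "C \<in> carrier \<Gamma>" using sub by blast+
    then obtain z w v where e: "z \<noteq> 0" "w \<noteq> 0" "v \<noteq> 0" "A = val z" "B = val w" "C = val v"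
      by (metis carrierE)
    then have "(inverse z * w) * (inverse w * v) \<in> R" using * mult_R by (simp add: le_iff)
    moreover have "(inverse z * w) * (inverse w * v) = inverse z * v"
      using e by (simp add: mult.assoc mult_inverse_cancel)
    ultimately show "(A, C) \<in> le_rel \<Gamma>" using e by (simp add: le_iff)
  qed
  moreover have "antisym (le_rel \<Gamma>)"
  proof (rule antisymI)
    fix A B assume *: "(A, B) \<in> le_rel \<Gamma>" "(B, A) \<in> le_rel \<Gamma>"
    then obtain z w where e: "z \<noteq> 0" "w \<noteq> 0" "A = val z" "B = val w"
      using sub by (auto elim!: carrierE)
    then have "inverse z * w \<in> R" "inverse w * z \<in> R" using * by (simp_all add: le_iff)
    then have "inverse z * w \<in> U" using e by (simp add: U_def nonzero_inverse_mult_distrib)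
    then show "A = B" using e val_eq_iff by simp
  qed
  moreover have "total_on (carrier \<Gamma>) (le_rel \<Gamma>)"
  proof (rule total_onI)
    fix A B assume "A \<in> carrier \<Gamma>" "B \<in> carrier \<Gamma>"
    then obtain z w where e: "z \<noteq> 0" "w \<noteq> 0" "A = val z" "B = val w" by (auto elim!: carrierE)
    then show "(A, B) \<in> le_rel \<Gamma> \<or> (B, A) \<in> le_rel \<Gamma>"
      using total_R[of "inverse z * w"] by (simp add: le_iff nonzero_inverse_mult_distrib)
  qed
  ultimately show ?thesis using sub by (simp add: order_on_defs)
qed

lemma valuation_val: "valuation \<Gamma> val"
proof -
  interpret group \<Gamma> by (rule group_\<Gamma>)
  have sub: "le_rel \<Gamma> \<subseteq> carrier \<Gamma> \<times> carrier \<Gamma>" by (auto simp: \<Gamma>_def)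
  show ?thesis
  proof
    show "linear_order_on (carrier \<Gamma>) (le_rel \<Gamma>)" by (rule linear_\<Gamma>)
  next
    fix A B C assume *: "(A, B) \<in> le_rel \<Gamma>" "C \<in> carrier \<Gamma>"
    then obtain z w v where e: "z \<noteq> 0" "w \<noteq> 0" "v \<noteq> 0" "A = val z" "B = val w" "C = val v"
      using sub by (auto elim!: carrierE)
    have zw: "inverse z * w \<in> R" using * e by (simp add: le_iff)
    have "inverse (v * z) * (v * w) = inverse z * w"
      using e by (simp add: nonzero_inverse_mult_distrib mult.assoc mult_inverse_cancel)
    then show "(C \<otimes>\<^bsub>\<Gamma>\<^esub> A, C \<otimes>\<^bsub>\<Gamma>\<^esub> B) \<in> le_rel \<Gamma>" using e zw by (simp add: val_times le_iff)
    have "inverse (z * v) * (w * v) = inverse v * (inverse z * w) * v"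
      using e by (simp add: nonzero_inverse_mult_distrib mult.assoc)
    then show "(A \<otimes>\<^bsub>\<Gamma>\<^esub> C, B \<otimes>\<^bsub>\<Gamma>\<^esub> C) \<in> le_rel \<Gamma>"
      using e conj_R'[OF e(3) zw] by (simp add: val_times le_iff)
  next
    show "val \<in> epi mult_group \<Gamma>"
      by (auto simp: epi_def hom_def val_times val_carrier) (auto simp: \<Gamma>_def)
  next
    fix a b :: 'a assume ab: "a \<noteq> 0" "b \<noteq> 0" "b \<noteq> - a"
    then have s: "a + b \<noteq> 0" by (metis add.commute eq_neg_iff_add_eq_0)
    show "(ogroup_min \<Gamma> (val a) (val b), val (a + b)) \<in> le_rel \<Gamma>"
    proof (cases "inverse a * b \<in> R")
      case True
      then have "inverse a * (a + b) \<in> R" using ab add_R[OF one_R True] by (simp add: distrib_left)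
      then show ?thesis using ab s True by (simp add: ogroup_min_def le_iff)
    next
      case False
      then have "inverse b * a \<in> R"
        using total_R[of "inverse a * b"] ab by (simp add: nonzero_inverse_mult_distrib)
      then have "inverse b * (a + b) \<in> R" using ab add_R[OF _ one_R] by (simp add: distrib_left)
      then show ?thesis using ab s False by (simp add: ogroup_min_def le_iff)
    qed
  qed
qed

lemma carrier_nontrivial: "z \<noteq> 0 \<Longrightarrow> z \<notin> R \<Longrightarrow> carrier \<Gamma> \<noteq> {\<one>\<^bsub>\<Gamma>\<^esub>}"
  using val_carrier[of z] val_eq_iff[of 1 z] by (auto simp: one_\<Gamma> U_def)

lemma openin_val:
  assumes N: "subgroup N mult_group" and t: "t \<noteq> 0" "t \<in> R" "\<And>z. z \<in> R \<Longrightarrow> 1 + t * z \<in> N"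
  shows "openin (val_topology \<Gamma> val) N"
proof -
  interpret valuation \<Gamma> val by (rule valuation_val)
  have "1 + y \<in> N" if y: "y \<in> val_ideal \<Gamma> val (val t)" for y
  proof (cases "y = 0")
    case True
    then show ?thesis using subgroup.one_closed[OF N] by simp
  next
    case False
    then have "inverse t * y \<in> R" using y t by (simp add: val_ideal_def le_iff)
    then show ?thesis using t(3)[of "inverse t * y"] t(1) by (simp add: mult.assoc[symmetric])
  qed
  then show ?thesis unfolding openin_subgroup_iff[OF N]
    using t by (intro bexI[of _ "val t"]) (auto simp: val_carrier one_\<Gamma> le_iff)
qed

end

subsection \<open>The valuation ring of power bounded norms\<close>

text \<open>The scalar \<open>c\<close> moves bounded elements into \<open>W\<close>, and
  \<open>1 + c W\<close> lies in \<open>N\<close>. In the bound for the norm, \<open>d\<close>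
  counts the factors of a determinant term, and the extra one in \<open>Suc k\<close> is the loss in
  the coordinate operators.\<close>

locale scaled_ring =
  fixes W N :: "'a::division_ring set" and c :: 'a and nrm :: "'a \<Rightarrow> 'a" and d :: nat
  assumes W_0: "0 \<in> W"
    and W_plus: "z \<in> W \<Longrightarrow> w \<in> W \<Longrightarrow> z + w \<in> W"
    and W_uminus: "z \<in> W \<Longrightarrow> - z \<in> W"
    and W_mult: "z \<in> W \<Longrightarrow> w \<in> W \<Longrightarrow> z * w \<in> W"
    and c_central: "central c" and c_nonzero: "c \<noteq> 0" and c_W: "c \<in> W"
    and one_plus_c: "w \<in> W \<Longrightarrow> 1 + c * w \<in> N" and zero_N: "0 \<notin> N"
    and c_total: "z \<noteq> 0 \<Longrightarrow> c * z \<in> W \<or> c * inverse z \<in> W"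
    and nrm_central: "central (nrm z)" and nrm_1: "nrm 1 = 1"
    and nrm_mult: "nrm (z * w) = nrm z * nrm w"
    and nrm_c: "nrm c = c ^ d" and d_pos: "d > 0"
    and nrm_bound: "c ^ k * z \<in> W \<Longrightarrow> c ^ (d * Suc k) * nrm z \<in> W"
begin

lemma c_power_W: "k > 0 \<Longrightarrow> c ^ k \<in> W"
proof (induction k)
  case (Suc k)
  then show ?case using c_W W_mult by (cases k) auto
qed simp

lemma c_power_mult_W: "w \<in> W \<Longrightarrow> c ^ k * w \<in> W"
  using c_power_W[of k] W_mult by (cases k) auto

lemma c_power_commute: "z * (c ^ k * w) = c ^ k * (z * w)"
  by (rule central_left_commute[OF central_power[OF c_central]])

lemma c_power_add: "c ^ i * (c ^ j * z) = c ^ (i + j) * z"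
  by (simp add: power_add mult.assoc)

lemma power_scaled: "(c ^ k * w) ^ j = c ^ (k * j) * w ^ j"
proof (induction j)
  case (Suc j)
  have "c ^ k * w * (c ^ (k * j) * w ^ j) = c ^ (k * j) * (c ^ k * w * w ^ j)"
    by (rule c_power_commute)
  then show ?case using Suc by (simp add: mult.assoc c_power_add add.commute)
qed simp

lemma W_power: "w \<in> W \<Longrightarrow> j > 0 \<Longrightarrow> w ^ j \<in> W"
proof (induction j)
  case (Suc j)
  then show ?case using W_mult by (cases j) auto
qed simp

text \<open>Otherwise 0 would lie in \<open>1 + c W\<close>, hence in \<open>N\<close>. The
  contradictions below all come down to this: no positive power of \<open>c\<close> may survive in
  an expression for 1.\<close>

lemma one_not_scaled: "w \<in> W \<Longrightarrow> k > 0 \<Longrightarrow> c ^ k * w \<noteq> 1"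
proof
  assume *: "w \<in> W" "k > 0" "c ^ k * w = 1"
  then obtain j where "k = Suc j" by (cases k) auto
  then have "1 + c * (- (c ^ j * w)) = 0" using * by (simp add: mult.assoc)
  then show False using one_plus_c[OF W_uminus[OF c_power_mult_W[OF *(1)]], of j] zero_N by simp
qed

lemma c_power_eq: "w \<in> W \<Longrightarrow> j > i \<Longrightarrow> c ^ i \<noteq> c ^ j * w"
proof
  assume *: "w \<in> W" "j > i" "c ^ i = c ^ j * w"
  have "c ^ i * (c ^ (j - i) * w) = c ^ j * w"
    using *(2) by (simp only: c_power_add le_add_diff_inverse less_imp_le)
  then have "c ^ i * (c ^ (j - i) * w) = c ^ i * 1" using *(3) by (simp only: mult_1_right)
  then have "c ^ (j - i) * w = 1" using c_nonzero by (metis mult_left_cancel power_not_zero)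
  then show False using one_not_scaled[OF *(1), of "j - i"] *(2) by simp
qed

text \<open>Apply \<open>c_total\<close> to \<open>c ^ Suc k * z\<close>. The inverse picks up one
  factor \<open>c\<close>, which cancels one of the \<open>Suc k\<close> factors and leaves
  \<open>c ^ k\<close>.\<close>

lemma not_scaled_imp_inverse:
  assumes "z \<noteq> 0" "c ^ Suc (Suc k) * z \<notin> W"
  obtains w where "w \<in> W" "inverse z = c ^ k * w"
proof -
  have nz: "c ^ Suc k * z \<noteq> 0" using assms c_nonzero by simp
  have "c * (c ^ Suc k * z) \<notin> W" using assms by (simp add: mult.assoc)
  then have w: "c * inverse (c ^ Suc k * z) \<in> W" using c_total[OF nz] by blast
  have "c ^ k * (c * inverse (c ^ Suc k * z)) = inverse z"
  proof -
    have "inverse (c ^ Suc k * z) = inverse z * inverse (c ^ Suc k)"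
      using assms c_nonzero by (intro nonzero_inverse_mult_distrib) auto
    also have "\<dots> = inverse (c ^ Suc k) * inverse z"
      using central_commute[OF central_inverse[OF central_power[OF c_central]], of "Suc k"] by simp
    finally have "c ^ k * (c * inverse (c ^ Suc k * z)) = (c ^ Suc k * inverse (c ^ Suc k)) * inverse z"
      by (simp only: mult.assoc[symmetric] power_Suc2)
    then show ?thesis using c_nonzero by simp
  qed
  then show ?thesis using that[OF w] by simp
qed

definition bdd :: "'a \<Rightarrow> bool" where
  "bdd z \<longleftrightarrow> (\<exists>k. \<forall>j. c ^ k * z ^ j \<in> W)"

text \<open>The exponent becomes uniform in \<open>z\<close>: if 3 failed for \<open>z ^ i\<close>,
  the inverse of \<open>z ^ i\<close> would be in \<open>c W\<close>, and its power
  \<open>Suc k\<close> would beat the fixed bound \<open>c ^ k\<close>.\<close>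

lemma bdd_power_bound:
  assumes "bdd z" shows "c ^ 3 * z ^ i \<in> W"
proof (cases "z = 0")
  case True
  then show ?thesis using c_power_W[of 3] W_0 by (cases i) auto
next
  case False
  obtain k where k: "\<And>j. c ^ k * z ^ j \<in> W" using assms bdd_def by blast
  show ?thesis
  proof (rule ccontr)
    assume neg: "c ^ 3 * z ^ i \<notin> W"
    have zi: "z ^ i \<noteq> 0" using False by simp
    obtain w where w: "w \<in> W" "inverse (z ^ i) = c ^ 1 * w"
      using not_scaled_imp_inverse[OF zi, of 1] neg by (auto simp: numeral_3_eq_3)
    have "(z ^ i) ^ Suc k * inverse (z ^ i) ^ Suc k = 1"
      unfolding power_inverse using zi by (intro right_inverse) simp
    then have "z ^ (i * Suc k) * (c ^ Suc k * w ^ Suc k) = 1"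
      unfolding w(2) power_scaled by (simp only: power_mult mult_1_left)
    then have "c ^ k * (z ^ (i * Suc k) * (c ^ Suc k * w ^ Suc k)) = c ^ k" by simp
    then have "c ^ k = c ^ Suc k * ((c ^ k * z ^ (i * Suc k)) * w ^ Suc k)"
      by (simp only: c_power_commute[of "z ^ _"] c_power_commute[of "c ^ k" "Suc k"] mult.assoc)
    then show False using c_power_eq[OF W_mult[OF k W_power[OF w(1)]]] by blast
  qed
qed

text \<open>If \<open>c ^ 3 * y ^ r\<close> were outside \<open>W\<close>, the inverse of
  \<open>y ^ r\<close> would lie in \<open>c W\<close>. Its \<open>j\<close>-th power times
  \<open>(y ^ j) ^ r\<close>, which is in \<open>W\<close>, would then be a scaled expression for
  1.\<close>

lemma power_in_W_imp_bdd:
  assumes y: "y \<noteq> 0" "y ^ j \<in> W" "j > 0" shows "bdd y"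
proof -
  have "c ^ 3 * y ^ r \<in> W" for r
  proof (rule ccontr)
    assume neg: "c ^ 3 * y ^ r \<notin> W"
    then have r: "r > 0" using c_power_W[of 3] by (cases r) auto
    have yr: "y ^ r \<noteq> 0" using y by simp
    obtain w where w: "w \<in> W" "inverse (y ^ r) = c ^ 1 * w"
      using not_scaled_imp_inverse[OF yr, of 1] neg by (auto simp: numeral_3_eq_3)
    have "inverse (y ^ r) ^ j * (y ^ r) ^ j = 1"
      unfolding power_inverse using yr by (intro left_inverse) simp
    then have "c ^ j * w ^ j * (y ^ j) ^ r = 1"
      unfolding w(2) power_scaled by (simp only: power_mult[symmetric] mult_1_left mult.commute[of r j])
    moreover have "w ^ j * (y ^ j) ^ r \<in> W" using W_mult W_power w(1) y r by blast
    ultimately show False using one_not_scaled[of "w ^ j * (y ^ j) ^ r" j] y(3) by (simp add: mult.assoc)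
  qed
  then show ?thesis unfolding bdd_def by blast
qed

lemma bdd_total:
  assumes "z \<noteq> 0" shows "bdd z \<or> bdd (inverse z)"
proof (rule disjCI)
  assume "\<not> bdd (inverse z)"
  then obtain j where j: "c ^ 2 * inverse z ^ j \<notin> W" unfolding bdd_def by blast
  then have j0: "j > 0" using c_power_W[of 2] by (cases j) auto
  obtain w where "w \<in> W" "inverse (inverse z ^ j) = c ^ 0 * w"
    using not_scaled_imp_inverse[of "inverse z ^ j" 0] j assms by (auto simp: numeral_2_eq_2)
  then have "z ^ j \<in> W" by (simp add: power_inverse)
  then show "bdd z" using power_in_W_imp_bdd assms j0 by blast
qed

lemma bdd_mult:
  assumes "bdd z" "bdd w" "central z" shows "bdd (z * w)"
proof -
  have p: "(z * w) ^ j = z ^ j * w ^ j" for j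
  proof (induction j)
    case (Suc j)
    then show ?case
      using central_left_commute[OF central_power[OF assms(3)], of w j "w ^ j"] by (simp add: mult.assoc)
  qed simp
  show ?thesis unfolding bdd_def
  proof (intro exI[of _ 6] allI)
    fix j
    have "(c ^ 3 * z ^ j) * (c ^ 3 * w ^ j) \<in> W" using assms bdd_power_bound W_mult by blast
    moreover have "(c ^ 3 * z ^ j) * (c ^ 3 * w ^ j) = c ^ 6 * (z * w) ^ j"
      by (simp add: p mult.assoc c_power_commute[of "z ^ j" 3] c_power_add)
    ultimately show "c ^ 6 * (z * w) ^ j \<in> W" by simp
  qed
qed

lemma nrm_times_inverse: "z \<noteq> 0 \<Longrightarrow> nrm z * nrm (inverse z) = 1"
  using nrm_mult[of z "inverse z"] nrm_1 by simp

lemma nrm_nonzero: "z \<noteq> 0 \<Longrightarrow> nrm z \<noteq> 0"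
  using nrm_times_inverse[of z] by auto

lemma nrm_inverse: "z \<noteq> 0 \<Longrightarrow> nrm (inverse z) = inverse (nrm z)"
  using nrm_times_inverse[of z] inverse_unique[of "nrm z" "nrm (inverse z)"] by simp

lemma nrm_power: "nrm (z ^ j) = nrm z ^ j"
  by (induction j) (simp_all add: nrm_1 nrm_mult)

text \<open>Otherwise \<open>inverse v = c ^ 5 * w\<close>, and the norm of
  \<open>v * inverse v\<close> expresses 1 with the factor \<open>c ^ (4 * d - 3)\<close> in front.
  Here 5 is the least \<open>e\<close> with \<open>e * d > d + 3\<close> for every positive
  \<open>d\<close>; two more factors are lost in \<open>not_scaled_imp_inverse\<close>.\<close>

lemma nrm_bound_imp_bound:
  assumes v: "v \<noteq> 0" "c ^ 3 * nrm v \<in> W" shows "c ^ 7 * v \<in> W"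
proof (rule ccontr)
  assume neg: "c ^ 7 * v \<notin> W"
  have "c ^ Suc (Suc 5) * v \<notin> W" using neg by simp
  then obtain w where w: "w \<in> W" "inverse v = c ^ 5 * w"
    using not_scaled_imp_inverse[OF v(1)] by blast
  have "c ^ d * nrm w \<in> W" using nrm_bound[of 0 w] w by simp
  then have in_W: "(c ^ 3 * nrm v) * (c ^ d * nrm w) \<in> W" using W_mult v by blast
  have "5 * d = (4 * d - 3) + (3 + d)" using d_pos by simp
  moreover have "c ^ (4 * d - 3) * ((c ^ 3 * nrm v) * (c ^ d * nrm w))
      = c ^ ((4 * d - 3) + (3 + d)) * (nrm v * nrm w)"
    by (simp only: mult.assoc c_power_commute[of "nrm v" d] c_power_add add.assoc)
  moreover have "nrm v * nrm (inverse v) = c ^ (5 * d) * (nrm v * nrm w)"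
    unfolding w(2) nrm_mult nrm_power nrm_c
    by (simp only: mult.assoc c_power_commute[of "nrm v"] power_mult[symmetric] mult.commute[of d])
  ultimately have "c ^ (4 * d - 3) * ((c ^ 3 * nrm v) * (c ^ d * nrm w)) = 1"
    using nrm_times_inverse[OF v(1)] by metis
  then show False using one_not_scaled[OF in_W, of "4 * d - 3"] d_pos by auto
qed

text \<open>The condition is put on the norm since \<open>bdd_mult\<close> wants a central factor;
  \<open>nrm_bound_imp_bound\<close> transfers it back to the powers of \<open>z\<close>
  itself.\<close>

definition R :: "'a set" where
  "R = {z. z = 0 \<or> bdd (nrm z)}"

lemma R_powers:
  assumes "z \<in> R" shows "c ^ 7 * z ^ j \<in> W"
proof (cases "z = 0")
  case True
  then show ?thesis using c_power_W[of 7] W_0 by (cases j) auto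
next
  case False
  then have "c ^ 3 * nrm (z ^ j) \<in> W"
    using assms bdd_power_bound by (simp add: R_def nrm_power)
  then show ?thesis using nrm_bound_imp_bound False by simp
qed

text \<open>\<open>W\<close> is an additive group, so the number of terms in the expansion of
  \<open>(1 + z) ^ j\<close> does not affect the bound. The extra factor \<open>z ^ i\<close> lets
  the induction avoid binomial coefficients.\<close>

lemma R_one_plus:
  assumes "z \<in> R" shows "1 + z \<in> R"
proof -
  have "c ^ 7 * ((1 + z) ^ j * z ^ i) \<in> W" for i j
  proof (induction j arbitrary: i)
    case 0
    then show ?case using R_powers[OF assms] by simp
  next
    case (Suc j)
    have "(1 + z) ^ Suc j * z ^ i = (1 + z) ^ j * z ^ i + (1 + z) ^ j * z ^ Suc i"
      by (simp add: power_Suc2 algebra_simps del: power_Suc) (simp add: power_commutes mult.assoc)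
    then show ?case using W_plus[OF Suc.IH[of i] Suc.IH[of "Suc i"]] by (simp only: distrib_left)
  qed
  from this[of _ 0] have "c ^ 7 * (1 + z) ^ j \<in> W" for j by simp
  then have "c ^ (d * Suc 7) * nrm (1 + z) ^ j \<in> W" for j
    using nrm_bound[of 7 "(1 + z) ^ j"] by (simp only: nrm_power)
  then show ?thesis by (auto simp: R_def bdd_def)
qed

lemma R_mult: "z \<in> R \<Longrightarrow> w \<in> R \<Longrightarrow> z * w \<in> R"
  using bdd_mult nrm_central by (auto simp: R_def nrm_mult)

lemma R_total: "z \<noteq> 0 \<Longrightarrow> z \<in> R \<or> inverse z \<in> R"
  using bdd_total[OF nrm_nonzero] by (auto simp: R_def nrm_inverse)

lemma R_add:
  assumes "z \<in> R" "w \<in> R" shows "z + w \<in> R"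
proof (cases "z = 0 \<or> w = 0")
  case False
  show ?thesis
  proof (cases "inverse z * w \<in> R")
    case True
    then have "z * (1 + inverse z * w) \<in> R" using R_mult R_one_plus assms by blast
    then show ?thesis using False by (simp add: distrib_left mult.assoc[symmetric])
  next
    case zw: False
    then have "inverse w * z \<in> R"
      using R_total[of "inverse z * w"] False by (simp add: nonzero_inverse_mult_distrib)
    then have "w * (1 + inverse w * z) \<in> R" using R_mult R_one_plus assms by blast
    then show ?thesis using False by (simp add: distrib_left mult.assoc[symmetric] add.commute)
  qed
qed (use assms in auto)

lemma R_conj:
  assumes "g \<noteq> 0" "z \<in> R" shows "g * z * inverse g \<in> R"
proof -
  have "nrm (g * z * inverse g) = nrm z * (nrm g * nrm (inverse g))"
    using central_commute[OF nrm_central, of z "nrm g"] by (simp add: nrm_mult mult.assoc[symmetric])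
  then show ?thesis using assms by (auto simp: R_def nrm_times_inverse)
qed

lemma bdd_c_power: "bdd (c ^ k)"
proof -
  have "c ^ 1 * (c ^ k) ^ j \<in> W" for j using c_power_W[of "Suc (k * j)"] by (simp add: power_mult)
  then show ?thesis unfolding bdd_def by blast
qed

lemma invariant_valuation_ring_R: "invariant_valuation_ring R"
proof
  show "1 \<in> R" using bdd_c_power[of 0] by (simp add: R_def nrm_1)
qed (use R_add R_mult R_conj R_total in auto)

lemma c_power_R: "c ^ k \<in> R"
  using bdd_c_power[of "d * k"] by (simp add: R_def nrm_power nrm_c power_mult)

text \<open>The eighth power of \<open>inverse c\<close> outweighs the \<open>c ^ 7\<close> allowed
  by \<open>R_powers\<close>. This makes the valuation non-trivial.\<close>

lemma inverse_c_not_R: "inverse c \<notin> R"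
proof
  assume "inverse c \<in> R"
  then have "c ^ 7 * inverse c ^ 8 \<in> W" by (rule R_powers)
  moreover have "c ^ 7 * inverse c ^ 8 = inverse c"
    using c_nonzero by (simp add: power_inverse[symmetric] numeral_eq_Suc mult.assoc[symmetric])
      (simp add: power_inverse mult.assoc)
  ultimately show False using one_not_scaled[of "inverse c" 1] c_nonzero by simp
qed

lemma one_plus_scaled_R: "z \<in> R \<Longrightarrow> 1 + c ^ 8 * z \<in> N"
  using one_plus_c[of "c ^ 7 * z"] R_powers[of z 1]
  by (simp add: mult.assoc[symmetric] numeral_eq_Suc)

lemma ex_valuation:
  assumes "subgroup N mult_group"
  shows "\<exists>(\<Gamma> :: 'a set ordered_group) v.
    valuation \<Gamma> v \<and> carrier \<Gamma> \<noteq> {\<one>\<^bsub>\<Gamma>\<^esub>} \<and> openin (val_topology \<Gamma> v) N"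
proof -
  interpret O: invariant_valuation_ring R by (rule invariant_valuation_ring_R)
  have "openin (val_topology O.\<Gamma> O.val) N"
    by (rule O.openin_val[OF assms, of "c ^ 8"]) (use c_nonzero c_power_R one_plus_scaled_R in auto)
  then show ?thesis
    using O.valuation_val O.carrier_nontrivial[OF _ inverse_c_not_R] c_nonzero by auto
qed

end

subsection \<open>From V-graphs to adjacency of cosets\<close>

lemma (in wf_digraph) awalk_cost_1: "awalk_cost (\<lambda>_. 1) p = real (length p)"
  by (induction p) simp_all

lemma graph_dist_le_1_iff:
  assumes "pair_graph \<Delta>" "u \<in> pverts \<Delta>"
  shows "graph_dist \<Delta> u v \<le> 1 \<longleftrightarrow> u = v \<or> (u, v) \<in> parcs \<Delta>"
proof -
  interpret pair_graph \<Delta> by fact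
  show ?thesis
  proof
    assume "graph_dist \<Delta> u v \<le> 1"
    \<comment> \<open>The distance is an infimum over walks; a strict bound produces an actual walk,
      and fewer than two arcs means at most one.\<close>
    then have "\<mu> (\<lambda>_. 1) u v < ereal 2" unfolding graph_dist_def
      by (rule le_less_trans) simp
    then obtain p where p: "awalk u p v" "length p < 2"
      by (auto simp: \<mu>_def INF_less_iff awalk_cost_1)
    then consider "p = []" | e where "p = [e]" by (cases p; cases "tl p") auto
    then show "u = v \<or> (u, v) \<in> parcs \<Delta>"
      by cases (use p(1) in \<open>auto simp: awalk_def pcas.simps\<close>)
  next
    assume "u = v \<or> (u, v) \<in> parcs \<Delta>"
    then show "graph_dist \<Delta> u v \<le> 1"
    proof
      assume "u = v"
      then have "awalk u [] v" using assms(2) by (simp add: awalk_Nil_iff)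
      from min_cost_le_walk_cost[OF this, of "\<lambda>_. 1"] show ?thesis
        unfolding graph_dist_def by (auto simp: awalk_cost_1 zero_ereal_def[symmetric] intro: order_trans)
    next
      assume "(u, v) \<in> parcs \<Delta>"
      then have "awalk u [(u, v)] v" using arc_implies_awalk[of "(u, v)"] by simp
      from min_cost_le_walk_cost[OF this, of "\<lambda>_. 1"] show ?thesis
        unfolding graph_dist_def by (simp add: awalk_cost_1 one_ereal_def)
    qed
  qed
qed

lemma graph_dist_le_3:
  assumes "pair_graph \<Delta>" "u \<in> pverts \<Delta>"
    and "u = p \<or> (u, p) \<in> parcs \<Delta>" "p = q \<or> (p, q) \<in> parcs \<Delta>" "q = v \<or> (q, v) \<in> parcs \<Delta>"
  shows "graph_dist \<Delta> u v \<le> 3"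
proof -
  interpret pair_graph \<Delta> by fact
  have step: "\<exists>p. awalk a p b \<and> length p \<le> 1" if "a \<in> pverts \<Delta>" "a = b \<or> (a, b) \<in> parcs \<Delta>" for a b
    using that arc_implies_awalk[of "(a, b)"]
    by (auto simp: awalk_Nil_iff intro: exI[of _ "[]"] exI[of _ "[(a, b)]"])
  have "p \<in> pverts \<Delta>" using assms(2,3) in_arcsD2 by blast
  moreover from this have "q \<in> pverts \<Delta>" using assms(4) in_arcsD2 by blast
  ultimately obtain w1 w2 w3 where w: "awalk u w1 p" "awalk p w2 q" "awalk q w3 v"
    "length w1 \<le> 1" "length w2 \<le> 1" "length w3 \<le> 1"
    using step[OF assms(2,3)] step[OF _ assms(4)] step[OF _ assms(5)] by blast
  have "awalk u (w1 @ w2 @ w3) v" using w awalk_appendI by blast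
  from min_cost_le_walk_cost[OF this, of "\<lambda>_. 1"]
  have "graph_dist \<Delta> u v \<le> ereal (real (length w1 + length w2 + length w3))"
    unfolding graph_dist_def by (simp add: awalk_cost_1 add.assoc)
  also have "\<dots> \<le> ereal 3" using w by simp
  finally show ?thesis by simp
qed

lemma inv_mult_group_eq: "x \<noteq> 0 \<Longrightarrow> inv\<^bsub>mult_group\<^esub> x = inverse (x :: 'a::division_ring)"
  by (rule group.inv_equality[OF group_mult_group]) auto

lemma signed_normal_subgroup_normal:
  fixes N :: "'a::division_ring set"
  assumes "N \<lhd> mult_group" "- 1 \<in> N"
  shows "signed_normal_subgroup N"
proof -
  interpret normal N "mult_group :: 'a monoid" by fact
  show ?thesis
  proof
    show "inverse x \<in> N" if "x \<in> N" for x
    proof -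
      have "x \<noteq> 0" using subset that by auto
      show ?thesis using m_inv_closed[OF that] unfolding inv_mult_group_eq[OF \<open>x \<noteq> 0\<close>] .
    qed
    show "g * x * inverse g \<in> N" if "g \<noteq> 0" "x \<in> N" for g x
      using inv_op_closed2[of g x] that inv_mult_group_eq[of g] by simp
    show "1 \<in> N" using subgroup.one_closed[OF subgroup_axioms] by simp
    show "0 \<notin> N" using subset by auto
    show "x * y \<in> N" if "x \<in> N" "y \<in> N" for x y
      using subgroup.m_closed[OF subgroup_axioms that] by simp
  qed (rule assms)
qed

context signed_normal_subgroup
begin

abbreviation star :: "'a \<Rightarrow> 'a set" where
  "star a \<equiv> a <#\<^bsub>mult_group\<^esub> N"

lemma star_eq_iff: "g \<noteq> 0 \<Longrightarrow> h \<noteq> 0 \<Longrightarrow> star g = star h \<longleftrightarrow> h \<in> lcos g"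
proof -
  have mem: "k \<in> star g \<longleftrightarrow> k \<in> lcos g" if g: "g \<noteq> 0" for g k
  proof
    show "k \<in> lcos g" if "k \<in> star g"
      using that lcos_mult_right[OF g] by (auto simp: l_coset_def)
    show "k \<in> star g" if "k \<in> lcos g"
      using that by (auto simp: l_coset_def lcos_def mult.assoc[symmetric] intro: bexI[of _ "inverse g * k"])
  qed
  assume "g \<noteq> 0" "h \<noteq> 0"
  then show ?thesis using mem[of g] mem[of h] lcos_refl lcos_sym lcos_trans by blast
qed

lemma star_1: "star 1 = N"
  by (auto simp: l_coset_def)

lemma carrier_Mod:
  assumes "N \<lhd> mult_group" shows "carrier (mult_group Mod N) = star ` (UNIV - {0})"
proof -
  interpret normal N "mult_group :: 'a monoid" by fact
  show ?thesis using coset_eq by (auto simp: FactGroup_def RCOSETS_def)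
qed

lemma star_mult:
  assumes "N \<lhd> mult_group" "a \<noteq> 0" "b \<noteq> 0"
  shows "star a \<otimes>\<^bsub>mult_group Mod N\<^esub> star b = star (a * b)"
proof -
  interpret normal N "mult_group :: 'a monoid" by fact
  show ?thesis using rcos_sum[of a b] coset_eq assms by (simp add: FactGroup_def)
qed

text \<open>\<open>adj\<close> is distance at most 1 read on representatives. The side condition of
  (V3) that the product is outside \<open>N\<close> is part of the second adjacency in
  \<open>E_mult\<close>.\<close>

lemma coset_graph_V_graph:
  assumes "N \<lhd> mult_group" and V: "V_graph N \<Delta>"
  defines "adj \<equiv> \<lambda>g h. g \<noteq> 0 \<and> g \<notin> N \<and> h \<noteq> 0 \<and> h \<notin> N \<and> (star g = star h \<or> (star g, star h) \<in> parcs \<Delta>)"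
  shows "coset_graph N adj"
proof -
  have pg: "pair_graph \<Delta>" and verts: "pverts \<Delta> = carrier (mult_group Mod N) - {\<one>\<^bsub>mult_group Mod N\<^esub>}"
    using V by (auto simp: V_graph_def)
  interpret G: pair_graph \<Delta> by fact
  define d where "d g h = graph_dist \<Delta> (star g) (star h)" for g h
  have star_vert: "star g \<in> pverts \<Delta>" if "g \<noteq> 0" "g \<notin> N" for g
  proof -
    have "star g \<noteq> N" using that star_eq_iff[of 1 g] by (simp add: star_1 lcos_def)
    moreover have "star g \<in> carrier (mult_group Mod N)"
      unfolding carrier_Mod[OF assms(1)] using that by blast
    moreover have "\<one>\<^bsub>mult_group Mod N\<^esub> = N" by (simp add: FactGroup_def)
    ultimately show ?thesis by (simp add: verts)
  qed
  have d: "d g h \<le> 1 \<longleftrightarrow> adj g h" if "g \<noteq> 0" "g \<notin> N" "h \<noteq> 0" "h \<notin> N" for g h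
    using that graph_dist_le_1_iff[OF pg star_vert] by (simp add: d_def adj_def)
  have adj: "g \<noteq> 0 \<and> g \<notin> N \<and> h \<noteq> 0 \<and> h \<notin> N" if "adj g h" for g h
    using that by (simp add: adj_def)
  define X where "X = carrier mult_group - N"
  have X: "g \<in> X \<longleftrightarrow> g \<noteq> 0 \<and> g \<notin> N" for g by (simp add: X_def)
  have V': "\<forall>a\<in>X. \<forall>b\<in>X. a - b \<in> N \<longrightarrow> d a b \<le> 1"
    "\<forall>a\<in>X. \<forall>b\<in>X. d a b \<le> 1 \<longrightarrow> d (inverse a) b \<le> 1"
    "\<forall>a\<in>X. \<forall>b\<in>X. \<forall>c\<in>X. a * b \<notin> N \<and> d a c \<le> 1 \<and>
       graph_dist \<Delta> (star a \<otimes>\<^bsub>mult_group Mod N\<^esub> star b) (star c) \<le> 1 \<longrightarrow> d b c \<le> 1"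
    using V unfolding V_graph_def Let_def d_def X_def by blast+
  have V1: "d a b \<le> 1" if "a \<noteq> 0" "a \<notin> N" "b \<noteq> 0" "b \<notin> N" "a - b \<in> N" for a b
    using V'(1) that X by blast
  have V2: "d (inverse a) b \<le> 1" if "a \<noteq> 0" "a \<notin> N" "b \<noteq> 0" "b \<notin> N" "d a b \<le> 1" for a b
    using V'(2) that X by blast
  have V3: "d b c \<le> 1" if "a \<noteq> 0" "a \<notin> N" "b \<noteq> 0" "b \<notin> N" "c \<noteq> 0" "c \<notin> N" "a * b \<notin> N"
      "d a c \<le> 1" "d (a * b) c \<le> 1" for a b c
    using V'(3) that X star_mult[OF assms(1), of a b] unfolding d_def by metis
  show ?thesis
  proof
    show "adj h g" if "adj g h" for g h
      using that G.pair_sym_arcs by (auto simp: adj_def symmetric_def dest: symD)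
    show "adj g h'" if "adj g h" "h' \<in> lcos h" for g h h'
      using that star_eq_iff[of h h'] lcos_nonzero lcos_not_N[of h h'] by (auto simp: adj_def)
    show "adj g h" if "g \<noteq> 0" "g \<notin> N" "h \<noteq> 0" "h \<notin> N" "g - h \<in> N" for g h
      using V1 d that by blast
    show "adj (inverse g) h" if gh: "adj g h" for g h
    proof -
      have nz: "g \<noteq> 0" "g \<notin> N" "h \<noteq> 0" "h \<notin> N" using adj[OF gh] by blast+
      then have "d (inverse g) h \<le> 1" using V2 d gh by blast
      then show ?thesis using nz d[of "inverse g" h] by simp
    qed
    show "adj b c" if b: "b \<noteq> 0" "b \<notin> N" and ac: "adj a c" "adj (a * b) c" for a b c
    proof -
      have nz: "a \<noteq> 0" "a \<notin> N" "c \<noteq> 0" "c \<notin> N" "a * b \<noteq> 0" "a * b \<notin> N"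
        using adj[OF ac(1)] adj[OF ac(2)] by blast+
      then have "d b c \<le> 1" using V3 d ac b by blast
      then show ?thesis using nz b d by blast
    qed
  qed (auto simp: adj_def)
qed

end

section \<open>Finiteness over the centre and the conclusion\<close>

lemma finite_over_centre_commutative:
  assumes "\<forall>x y :: 'a::division_ring. x * y = y * x"
  shows "finite_over_centre TYPE('a)"
proof -
  have "z \<in> central_span {1}" for z :: 'a
    using assms by (intro central_spanI[of _ "\<lambda>_. z"]) (auto simp: central_def)
  then have "central_span {1 :: 'a} = UNIV" by blast
  then show ?thesis unfolding finite_over_centre_def by blast
qed

text \<open>The multiples \<open>scale r 1\<close> are central, so a basis over the base field also
  spans over the centre.\<close>

lemma finite_over_centre_division_algebra:
  fixes scale :: "'k::field \<Rightarrow> 'a::division_ring \<Rightarrow> 'a"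
  assumes "finite_dimensional_division_algebra scale"
  shows "finite_over_centre TYPE('a)"
proof -
  obtain B where "division_algebra scale" "finite_dimensional_vector_space scale B"
    using assms by (auto simp: finite_dimensional_division_algebra_def)
  interpret A: division_algebra scale by fact
  interpret B: finite_dimensional_vector_space scale B by fact
  have scale: "scale r z = scale r 1 * z" for r z
    using A.scale_mult_left[of r 1 z] by simp
  have central: "central (scale r 1)" for r
  proof -
    have "scale r 1 * w = w * scale r 1" for w
      using A.scale_mult_left[of r 1 w] A.scale_mult_right[of r w 1] by (metis mult_1_left mult_1_right)
    then show ?thesis by (simp add: central_def)
  qed
  have "z \<in> central_span B" for z
  proof -
    have "z \<in> range (\<lambda>u. \<Sum>v\<in>B. scale (u v) v)"
      using B.span_Basis A.span_finite[OF B.finite_Basis] by auto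
    then obtain u where "z = (\<Sum>v\<in>B. scale (u v) v)" by blast
    also have "\<dots> = (\<Sum>v\<in>B. scale (u v) 1 * v)" by (intro sum.cong refl scale)
    finally show ?thesis using central by (intro central_spanI[of _ "\<lambda>v. scale (u v) 1"]) auto
  qed
  then show ?thesis using B.finite_Basis unfolding finite_over_centre_def by blast
qed

lemma (in far_coset_graph) ex_valuation:
  assumes fin: "finite_over_centre TYPE('a)" and N: "subgroup N mult_group"
  shows "\<exists>(\<Gamma> :: 'a set ordered_group) v.
    valuation \<Gamma> v \<and> carrier \<Gamma> \<noteq> {\<one>\<^bsub>\<Gamma>\<^esub>} \<and> openin (val_topology \<Gamma> v) N"
proof (rule norm_over_centre[OF fin])
  fix J :: "('a \<Rightarrow> 'a) set" and nrm :: "'a \<Rightarrow> 'a" and d :: nat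
  assume J: "finite J" "\<And>f. f \<in> J \<Longrightarrow> elem_op f"
    and d: "d > 0" and nrm: "\<And>z. central (nrm z)" "nrm 1 = 1" "\<And>z w. nrm (z * w) = nrm z * nrm w"
      "\<And>c. central c \<Longrightarrow> nrm c = c ^ d"
    and bound: "\<And>W t z. 0 \<in> W \<Longrightarrow> (\<And>z w. z \<in> W \<Longrightarrow> w \<in> W \<Longrightarrow> z + w \<in> W) \<Longrightarrow>
       (\<And>z. z \<in> W \<Longrightarrow> - z \<in> W) \<Longrightarrow> (\<And>z w. z \<in> W \<Longrightarrow> w \<in> W \<Longrightarrow> z * w \<in> W) \<Longrightarrow> central t \<Longrightarrow>
       (\<And>f. f \<in> J \<Longrightarrow> t * f z \<in> W) \<Longrightarrow> t ^ d * nrm z \<in> W"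
  obtain c where c: "central c" "c \<noteq> 0" "c \<in> W" "\<And>w. w \<in> W \<Longrightarrow> 1 + c * w \<in> N"
    "\<And>z. z \<noteq> 0 \<Longrightarrow> c * z \<in> W \<or> c * inverse z \<in> W" "\<And>f w. f \<in> J \<Longrightarrow> w \<in> W \<Longrightarrow> c * f w \<in> W"
    using ex_central_scaling[OF fin J(1), of "\<lambda>f. f"] J(2) by blast
  have "c ^ (d * Suc k) * nrm z \<in> W" if kz: "c ^ k * z \<in> W" for k z
  proof -
    have "c ^ Suc k * f z \<in> W" if "f \<in> J" for f
      using c(6)[OF that kz] elem_op_central[OF J(2)[OF that] central_power[OF c(1)]]
      by (simp add: mult.assoc)
    then have "(c ^ Suc k) ^ d * nrm z \<in> W"
      by (intro bound[OF W_0 W_plus W_uminus W_mult central_power[OF c(1)]])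
    then show ?thesis by (simp only: power_mult[symmetric] mult.commute)
  qed
  then interpret scaled_ring W N c nrm d
    by unfold_locales (use c d nrm W_plus W_uminus W_mult in auto)
  show ?thesis by (rule ex_valuation[OF N])
qed

theorem theoremA:
  fixes N :: "'a::division_ring set"
    and \<Delta> :: "'a set pair_pre_digraph"
  assumes "infinite (UNIV :: 'a set)"
    and "N \<lhd> mult_group"
    and "finite (carrier (mult_group Mod N))"
    and "- 1 \<in> N"
    and "V_graph N \<Delta>"
    and "graph_diam \<Delta> \<ge> 4"
    and "(\<forall>x y :: 'a. x * y = y * x) \<or>
         ((\<exists>scale :: 'k::field \<Rightarrow> 'a \<Rightarrow> 'a. finite_dimensional_division_algebra scale) \<and>
          finite_transcendence_degree TYPE('k))"
  shows "\<exists>(\<Gamma> :: 'a set ordered_group) (v :: 'a \<Rightarrow> 'a set).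
           valuation \<Gamma> v \<and> carrier \<Gamma> \<noteq> {\<one>\<^bsub>\<Gamma>\<^esub>} \<and> openin (val_topology \<Gamma> v) N"
proof -
  have fin: "finite_over_centre TYPE('a)"
    using assms(7) finite_over_centre_commutative finite_over_centre_division_algebra by blast
  interpret signed_normal_subgroup N by (rule signed_normal_subgroup_normal) fact+
  define adj where "adj g h \<longleftrightarrow> g \<noteq> 0 \<and> g \<notin> N \<and> h \<noteq> 0 \<and> h \<notin> N \<and>
    (star g = star h \<or> (star g, star h) \<in> parcs \<Delta>)" for g h
  interpret G: coset_graph N adj
    using coset_graph_V_graph[OF assms(2,5)] by (simp add: adj_def[abs_def])
  have pg: "pair_graph \<Delta>" and verts: "pverts \<Delta> = carrier (mult_group Mod N) - {N}"
    using assms(5) by (auto simp: V_graph_def FactGroup_def)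
  \<comment> \<open>A strict bound below the supremum gives an actual pair of vertices, and distance
    greater than 3 is all that \<open>far\<close> requires.\<close>
  have "3 < graph_diam \<Delta>" by (rule less_le_trans[OF _ assms(6)]) simp
  then obtain u v where uv: "u \<in> pverts \<Delta>" "v \<in> pverts \<Delta>" "3 < graph_dist \<Delta> u v"
    unfolding graph_diam_def less_SUP_iff by blast
  then obtain x y where xy: "x \<noteq> 0" "y \<noteq> 0" "u = star x" "v = star y"
    by (auto simp: verts carrier_Mod[OF assms(2)])
  have "x \<notin> N" "y \<notin> N"
    using uv xy star_eq_iff[of 1] by (auto simp: verts star_1 lcos_def)
  moreover have False if "adj x p" "adj p q" "adj q y" for p q
    using graph_dist_le_3[OF pg uv(1), of "star p" "star q" v] that uv(3) xy(3,4)
    by (simp add: adj_def)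
  ultimately have far: "G.far x y"
    using xy unfolding G.far_def by blast
  define F where "F = (\<lambda>C. SOME a. a \<noteq> 0 \<and> C = star a) ` carrier (mult_group Mod N)"
  have F: "\<exists>g\<in>F. z \<in> lcos g" if z: "z \<noteq> 0" for z
  proof -
    define g where "g = (SOME a. a \<noteq> 0 \<and> star z = star a)"
    have "g \<noteq> 0 \<and> star z = star g" unfolding g_def by (rule someI[of _ z]) (simp add: z)
    moreover have "star z \<in> carrier (mult_group Mod N)"
      unfolding carrier_Mod[OF assms(2)] using z by blast
    then have "g \<in> F" unfolding F_def g_def by (rule imageI)
    ultimately show ?thesis using star_eq_iff[of g z] z by metis
  qed
  have finF: "finite F" using assms(3) by (simp add: F_def)
  interpret far_coset_graph N adj x y F
    using far difference_of_N[OF finF F assms(1)] finF F by unfold_locales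
  show ?thesis using ex_valuation[OF fin] assms(2) by (simp add: normal_def)
qed

end
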